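(* Let $m,p\ge2$, $N=m+p$, let $w\in\mathcal{S}$, and let $I\subseteq[1,m]$ and $\Lambda\subseteq[1,p]$ with $|I|=|\Lambda|$. Then $[I|\Lambda]\in\mathcal{M}(w)$ if and only if $[I|\Lambda](x)=0$ for all $x\in\overline{\mathcal{P}_{w_\circ^N w}}$.
   Context: Notation: $[a,b]$ denotes $\{a,a+1,\dots,b\}$. For $I\subseteq[1,m]$, $\Lambda\subseteq[1,p]$ with $|I|=|\Lambda|$, $[I|\Lambda]$ denotes the minor (determinant of the submatrix with rows $I$, columns $\Lambda$); the empty minor is $1$. The families $\mathcal{M}(w)$: let $\mathcal{S}=\{w\in S_N\mid -p\le w(i)-i\le m\ \forall i\}$. For a positive integer $r$ let $w_\circ^r\in S_r$ be $w_\circ^r(i)=r+1-i$. For finite $I,J\subset\mathbb{N}$ with $|I|=|J|=t$, $I=\{i_1<\dots<i_t\}$, $J=\{j_1<\dots<j_t\}$, write $I\le J$ if $i_l\le j_l$ for all $l$. For $w\in\mathcal{S}$, $\mathcal{M}(w)$ is the set of minors $[I|\Lambda]$ ($I\subseteq[1,m]$, $\Lambda\subseteq[1,p]$, $|I|=|\Lambda|$) satisfying at least one of: (1) $I\not\le w_\circ^m w(L)$ for all $L\subseteq[1,p]\cap w^{-1}[1,m]$ such that $|L|=|I|$ and $L\le\Lambda$. (2) $m+\Lambda\not\le w\,w_\circ^N(L)$ for all $L\subseteq[1,m]\cap w_\circ^N w^{-1}[m+1,N]$ such that $|L|=|\Lambda|$ and $L\le I$. (3) There exist $1\le r\le s\le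 p$ such that $|\Lambda\cap[r,s]|>|[r,s]\setminus w^{-1}[m+r,m+s]|$. (4) There exist $1\le r\le s\le m$ such that $|I\cap[r,s]|>|w_\circ^N[r,s]\setminus w^{-1}w_\circ^m[r,s]|$. Poisson structure: the coordinate ring $\mathcal{O}(\mathcal{M}_{m,p}(\mathbb{C}))=\mathbb{C}[Y_{i,\alpha}]$ is a Poisson algebra with $\{Y_{i,\alpha},Y_{k,\gamma}\}$ equal to $Y_{i,\alpha}Y_{k,\gamma}$ if $i=k$, $\alpha<\gamma$; $Y_{i,\alpha}Y_{k,\gamma}$ if $i<k$, $\alpha=\gamma$; $0$ if $i<k$, $\alpha>\gamma$; $2Y_{i,\gamma}Y_{k,\alpha}$ if $i<k$, $\alpha<\gamma$. The bracket extends uniquely to smooth functions, making $\mathcal{M}_{m,p}(\mathbb{C})$ a Poisson manifold; its symplectic leaves are the equivalence classes of the relation "connected by a piecewise Hamiltonian path", where a Hamiltonian path is a smooth path $\gamma:[0,1]\to\mathcal{M}_{m,p}(\mathbb{C})$ with $\gamma'(t)=\xi_f(\gamma(t))$ for some smooth $f$, $\xi_f$ being the vector field of the derivation $\{f,-\}$. The torus $\mathcal{H}=(\mathbb{C}^\times)^{m+p}$ acts by $(a_1,\dots,a_m,b_1,\dots,b_p).M=\mathrm{diag}(a_1,\dots,a_m)\,M\,\mathrm{diag}(b_1,\dots,b_p)$ and permutes the symplectic leaves; the $\mathcal{H}$-orbit of a leaf $\mathcal{L}$ is the set $\bigcup_{h\in\mathcal{H}}h.\mathcal{L}$. The orbits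 $\mathcal{P}_{w_\circ^Nw}$ (Brown–Goodearl–Yakimov): there are finitely many $\mathcal{H}$-orbits of symplectic leaves, they are smooth irreducible locally closed subvarieties, and they are parametrised bijectively by $w\in\mathcal{S}$. View $w$ as the permutation matrix with entries $w_{ij}=\delta_{i,w(j)}$, in block form $w=\begin{bmatrix} w_{11} & w_{12} \\ w_{21} & w_{22} \end{bmatrix}$ with $w_{11}$ of size $m\times p$, $w_{12}$ of size $m\times m$, $w_{21}$ of size $p\times p$, $w_{22}$ of size $p\times m$; also view $w_\circ^m$ as a permutation matrix. For a matrix $y$, $y[a,\dots,b;c,\dots,d]$ is the submatrix with rows $a,\dots,b$ and columns $c,\dots,d$. Then $\mathcal{P}_{w_\circ^N w}$ is the unique $\mathcal{H}$-orbit of symplectic leaves whose closure $\overline{\mathcal{P}_{w_\circ^N w}}$ is the set of $x\in\mathcal{M}_{m,p}(\mathbb{C})$ satisfying: (i) $\mathrm{rank}(x[r,\dots,m;1,\dots,s])\le\mathrm{rank}((w_\circ^m w_{11})[r,\dots,m;1,\dots,s])$ for $r\in[1,m]$, $s\in[1,p]$; (ii) $\mathrm{rank}(x[1,\dots,r;s,\dots,p])\le\mathrm{rank}((w_\circ^m w_{22}^{\mathrm{tr}})[1,\dots,r;s,\dots,p])$ for $r\in[1,m]$, $s\in[1,p]$; (iii) $\mathrm{rank}(x[1,\dots,m;r,\dots,s])\le s+1-r-\mathrm{rank}(w_{21}[r,\dots,p;r,\dots,s])$ for $2\le r\le s\le p$; (iv) $\mathrm{rank}(x[r,\dots,s;1,\dots,p])\le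 s+1-r-\mathrm{rank}((w_\circ^m w_{12}w_\circ^m)[r,\dots,s;1,\dots,s])$ for $1\le r\le s\le m-1$. *)

theory Defs
  imports
    "HOL-Analysis.Analysis"
    "HOL-Combinatorics.Permutations"
    "Jordan_Normal_Form.Determinant"
    "Jordan_Normal_Form.DL_Rank"
    "Jordan_Normal_Form.DL_Submatrix"
begin

text \<open>
  Matrices are those of \<^theory>\<open>Jordan_Normal_Form.Matrix\<close>, whose entries are indexed from \<open>0\<close>.
  Index sets \<open>I\<close>, \<open>\<Lambda>\<close>, permutations and the bounds in rank conditions are kept 1-based; the
  shift happens only in the conversions \<open>minor\<close>, \<open>block\<close> and \<open>perm_mat\<close>.
\<close>

section \<open>Minors, submatrices, permutation matrices\<close>

definition minor :: "nat set \<Rightarrow> nat set \<Rightarrow> complex mat \<Rightarrow> complex" where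
  "minor I \<Lambda> x = Determinant.det (submatrix x {i. Suc i \<in> I} {j. Suc j \<in> \<Lambda>})"

text \<open>The matrix \<open>x[a,\<dots>,b; c,\<dots>,d]\<close>.\<close>

definition block :: "complex mat \<Rightarrow> nat \<Rightarrow> nat \<Rightarrow> nat \<Rightarrow> nat \<Rightarrow> complex mat" where
  "block x a b c d = submatrix x {i. Suc i \<in> {a..b}} {j. Suc j \<in> {c..d}}"

definition mat_rank :: "complex mat \<Rightarrow> nat" where
  "mat_rank A = vec_space.rank (dim_row A) A"

definition perm_mat :: "nat \<Rightarrow> (nat \<Rightarrow> nat) \<Rightarrow> complex mat" where
  "perm_mat n w = Matrix.mat n n (\<lambda>(i, j). if Suc i = w (Suc j) then 1 else 0)"

definition longest :: "nat \<Rightarrow> nat \<Rightarrow> nat" where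
  "longest r i = (if i \<in> {1..r} then r + 1 - i else i)"

definition w11 :: "nat \<Rightarrow> nat \<Rightarrow> (nat \<Rightarrow> nat) \<Rightarrow> complex mat" where
  "w11 m p w = block (perm_mat (m + p) w) 1 m 1 p"

definition w12 :: "nat \<Rightarrow> nat \<Rightarrow> (nat \<Rightarrow> nat) \<Rightarrow> complex mat" where
  "w12 m p w = block (perm_mat (m + p) w) 1 m (p + 1) (m + p)"

definition w21 :: "nat \<Rightarrow> nat \<Rightarrow> (nat \<Rightarrow> nat) \<Rightarrow> complex mat" where
  "w21 m p w = block (perm_mat (m + p) w) (m + 1) (m + p) 1 p"

definition w22 :: "nat \<Rightarrow> nat \<Rightarrow> (nat \<Rightarrow> nat) \<Rightarrow> complex mat" where
  "w22 m p w = block (perm_mat (m + p) w) (m + 1) (m + p) (p + 1) (m + p)"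


section \<open>The set \<open>S\<close> of restricted permutations and the families \<open>M(w)\<close>\<close>

definition restricted_perms :: "nat \<Rightarrow> nat \<Rightarrow> (nat \<Rightarrow> nat) set" where
  "restricted_perms m p =
    {w. w permutes {1..m + p} \<and>
        (\<forall>i\<in>{1..m + p}. - int p \<le> int (w i) - int i \<and> int (w i) - int i \<le> int m)}"

definition set_le :: "nat set \<Rightarrow> nat set \<Rightarrow> bool" where
  "set_le I J \<longleftrightarrow> card I = card J \<and>
    (\<forall>l < card I. sorted_list_of_set I ! l \<le> sorted_list_of_set J ! l)"

text \<open>
  The minor \<open>[I|\<Lambda>]\<close> is represented in \<open>minor_family m p w\<close> by its pair of index sets;
  distinct pairs give distinct minors.
\<close>

definition minor_family :: "nat \<Rightarrow> nat \<Rightarrow> (nat \<Rightarrow> nat) \<Rightarrow> (nat set \<times> nat set) set" where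
  "minor_family m p w =
    {(I, \<Lambda>). I \<subseteq> {1..m} \<and> \<Lambda> \<subseteq> {1..p} \<and> card I = card \<Lambda> \<and>
      ((\<forall>L. L \<subseteq> {1..p} \<inter> inv_into UNIV w ` {1..m} \<and> card L = card I \<and> set_le L \<Lambda>
            \<longrightarrow> \<not> set_le I ((longest m \<circ> w) ` L))
       \<or> (\<forall>L. L \<subseteq> {1..m} \<inter> (longest (m + p) \<circ> inv_into UNIV w) ` {m + 1..m + p} \<and> card L = card \<Lambda>
              \<and> set_le L I
            \<longrightarrow> \<not> set_le ((\<lambda>l. m + l) ` \<Lambda>) ((w \<circ> longest (m + p)) ` L))
       \<or> (\<exists>r s. 1 \<le> r \<and> r \<le> s \<and> s \<le> p \<and>
            card (\<Lambda> \<inter> {r..s}) > card ({r..s} - inv_into UNIV w ` {m + r..m + s}))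
       \<or> (\<exists>r s. 1 \<le> r \<and> r \<le> s \<and> s \<le> m \<and>
            card (I \<inter> {r..s})
              > card (longest (m + p) ` {r..s} - (inv_into UNIV w \<circ> longest m) ` {r..s})))}"


section \<open>Topology and smooth functions on the space of \<open>m \<times> p\<close> matrices\<close>

text \<open>The Euclidean topology, transported from the space of families of \<open>m p\<close> entries.\<close>

definition mat_topology :: "nat \<Rightarrow> nat \<Rightarrow> complex mat topology" where
  "mat_topology m p =
    pullback_topology (carrier_mat m p) (\<lambda>x. restrict (\<lambda>ij. x $$ ij) ({..<m} \<times> {..<p}))
      (product_topology (\<lambda>_. euclidean) ({..<m} \<times> {..<p}))"

definition unit_mat_at :: "nat \<Rightarrow> nat \<Rightarrow> nat \<times> nat \<Rightarrow> complex mat" where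
  "unit_mat_at m p a = Matrix.mat m p (\<lambda>b. if b = a then 1 else 0)"

text \<open>
  The real line through \<open>x\<close> in direction \<open>c E\<^sub>a\<close>; for \<open>c = 1\<close> and \<open>c = \<i>\<close> these are the
  \<open>2 m p\<close> real coordinate directions.
\<close>

definition coord_line ::
  "nat \<Rightarrow> nat \<Rightarrow> nat \<times> nat \<Rightarrow> complex \<Rightarrow> complex mat \<Rightarrow> real \<Rightarrow> complex mat" where
  "coord_line m p a c x t = x + (of_real t * c) \<cdot>\<^sub>m unit_mat_at m p a"

definition real_partial ::
  "nat \<Rightarrow> nat \<Rightarrow> nat \<times> nat \<Rightarrow> complex \<Rightarrow> (complex mat \<Rightarrow> complex) \<Rightarrow> complex mat \<Rightarrow> complex" where
  "real_partial m p a c f x = vector_derivative (\<lambda>t. f (coord_line m p a c x t)) (at 0)"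

text \<open>
  Being a greatest fixed point, this says that \<open>f\<close> and all its iterated partial derivatives in
  the real coordinate directions exist and are continuous, i.e. that \<open>f\<close> is of class \<open>C\<^sup>\<infinity>\<close>.
\<close>

coinductive smooth_fun :: "nat \<Rightarrow> nat \<Rightarrow> (complex mat \<Rightarrow> complex) \<Rightarrow> bool" for m p where
  "\<lbrakk> continuous_map (mat_topology m p) euclidean f;
     \<forall>a \<in> {..<m} \<times> {..<p}. \<forall>c \<in> {1, \<i>}.
       (\<forall>x \<in> carrier_mat m p. (\<lambda>t::real. f (coord_line m p a c x t)) differentiable (at 0)) \<and>
       smooth_fun m p (real_partial m p a c f) \<rbrakk>
   \<Longrightarrow> smooth_fun m p f"

coinductive smooth_path :: "(real \<Rightarrow> complex) \<Rightarrow> bool" where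
  "\<lbrakk> \<forall>t \<in> {0..1}. (g has_vector_derivative g' t) (at t within {0..1}); smooth_path g' \<rbrakk>
   \<Longrightarrow> smooth_path g"


section \<open>The Poisson structure and its symplectic leaves\<close>

text \<open>
  \<open>half_bracket x a b\<close> lists the given values of \<open>{Y\<^sub>a, Y\<^sub>b}(x)\<close>, and is \<open>0\<close> when the value is
  prescribed only through antisymmetry.
\<close>

fun half_bracket :: "complex mat \<Rightarrow> nat \<times> nat \<Rightarrow> nat \<times> nat \<Rightarrow> complex" where
  "half_bracket x (i, \<alpha>) (k, \<gamma>) =
    (if i = k \<and> \<alpha> < \<gamma> then x $$ (i, \<alpha>) * x $$ (k, \<gamma>)
     else if i < k \<and> \<alpha> = \<gamma> then x $$ (i, \<alpha>) * x $$ (k, \<gamma>)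
     else if i < k \<and> \<alpha> > \<gamma> then 0
     else if i < k \<and> \<alpha> < \<gamma> then 2 * x $$ (i, \<gamma>) * x $$ (k, \<alpha>)
     else 0)"

definition coord_bracket :: "complex mat \<Rightarrow> nat \<times> nat \<Rightarrow> nat \<times> nat \<Rightarrow> complex" where
  "coord_bracket x a b = half_bracket x a b - half_bracket x b a"

text \<open>
  The Wirtinger derivative \<open>\<partial>f/\<partial>Y\<^sub>a\<close>, which is the usual complex partial derivative on
  polynomial and holomorphic functions.
\<close>

definition complex_partial ::
  "nat \<Rightarrow> nat \<Rightarrow> nat \<times> nat \<Rightarrow> (complex mat \<Rightarrow> complex) \<Rightarrow> complex mat \<Rightarrow> complex" where
  "complex_partial m p a f x =
    (real_partial m p a 1 f x - \<i> * real_partial m p a \<i> f x) / 2"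

text \<open>The extension of the bracket from coordinate functions as a biderivation (Leibniz rule).\<close>

definition poisson_bracket ::
  "nat \<Rightarrow> nat \<Rightarrow> (complex mat \<Rightarrow> complex) \<Rightarrow> (complex mat \<Rightarrow> complex) \<Rightarrow> complex mat \<Rightarrow> complex" where
  "poisson_bracket m p f g x =
    (\<Sum>a \<in> {..<m} \<times> {..<p}. \<Sum>b \<in> {..<m} \<times> {..<p}.
       complex_partial m p a f x * complex_partial m p b g x * coord_bracket x a b)"

text \<open>In coordinates, \<open>\<gamma>' = \<xi>\<^sub>f \<circ> \<gamma>\<close> reads \<open>(Y\<^sub>a \<circ> \<gamma>)' = {f, Y\<^sub>a} \<circ> \<gamma>\<close>.\<close>

definition hamiltonian_path :: "nat \<Rightarrow> nat \<Rightarrow> (real \<Rightarrow> complex mat) \<Rightarrow> bool" where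
  "hamiltonian_path m p \<gamma> \<longleftrightarrow>
    (\<forall>t \<in> {0..1}. \<gamma> t \<in> carrier_mat m p) \<and>
    (\<forall>a \<in> {..<m} \<times> {..<p}. smooth_path (\<lambda>t. \<gamma> t $$ a)) \<and>
    (\<exists>f. smooth_fun m p f \<and>
      (\<forall>t \<in> {0..1}. \<forall>a \<in> {..<m} \<times> {..<p}.
        ((\<lambda>u. \<gamma> u $$ a) has_vector_derivative poisson_bracket m p f (\<lambda>y. y $$ a) (\<gamma> t))
          (at t within {0..1})))"

definition hamiltonian_step :: "nat \<Rightarrow> nat \<Rightarrow> complex mat \<Rightarrow> complex mat \<Rightarrow> bool" where
  "hamiltonian_step m p x y \<longleftrightarrow> (\<exists>\<gamma>. hamiltonian_path m p \<gamma> \<and> \<gamma> 0 = x \<and> \<gamma> 1 = y)"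

definition symplectic_leaves :: "nat \<Rightarrow> nat \<Rightarrow> complex mat set set" where
  "symplectic_leaves m p =
    carrier_mat m p //
      {(x, y). x \<in> carrier_mat m p \<and> y \<in> carrier_mat m p \<and> (hamiltonian_step m p)\<^sup>*\<^sup>* x y}"


section \<open>Torus orbits of leaves and the orbit attached to \<open>w\<close>\<close>

definition torus :: "nat \<Rightarrow> nat \<Rightarrow> ((nat \<Rightarrow> complex) \<times> (nat \<Rightarrow> complex)) set" where
  "torus m p = {(a, b). (\<forall>i<m. a i \<noteq> 0) \<and> (\<forall>j<p. b j \<noteq> 0)}"

definition torus_act ::
  "nat \<Rightarrow> nat \<Rightarrow> (nat \<Rightarrow> complex) \<times> (nat \<Rightarrow> complex) \<Rightarrow> complex mat \<Rightarrow> complex mat" where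
  "torus_act m p h x = mat_diag m (fst h) * x * mat_diag p (snd h)"

definition leaf_orbits :: "nat \<Rightarrow> nat \<Rightarrow> complex mat set set" where
  "leaf_orbits m p =
    {(\<Union>h \<in> torus m p. torus_act m p h ` L) | L. L \<in> symplectic_leaves m p}"

definition rank_variety :: "nat \<Rightarrow> nat \<Rightarrow> (nat \<Rightarrow> nat) \<Rightarrow> complex mat set" where
  "rank_variety m p w =
    {x \<in> carrier_mat m p.
      (\<forall>r\<in>{1..m}. \<forall>s\<in>{1..p}.
         mat_rank (block x r m 1 s)
           \<le> mat_rank (block (perm_mat m (longest m) * w11 m p w) r m 1 s)) \<and>
      (\<forall>r\<in>{1..m}. \<forall>s\<in>{1..p}.
         mat_rank (block x 1 r s p)
           \<le> mat_rank (block (perm_mat m (longest m) * transpose_mat (w22 m p w)) 1 r s p)) \<and>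
      (\<forall>r s. 2 \<le> r \<and> r \<le> s \<and> s \<le> p \<longrightarrow>
         int (mat_rank (block x 1 m r s))
           \<le> int s + 1 - int r - int (mat_rank (block (w21 m p w) r p r s))) \<and>
      (\<forall>r s. 1 \<le> r \<and> r \<le> s \<and> s \<le> m - 1 \<longrightarrow>
         int (mat_rank (block x r s 1 p))
           \<le> int s + 1 - int r - int (mat_rank
                (block (perm_mat m (longest m) * w12 m p w * perm_mat m (longest m)) r s 1 s)))}"

text \<open>
  \<open>is_leaf_orbit_of m p w P\<close>: the set \<open>P\<close> is the torus orbit of symplectic leaves attached to
  \<open>w\<close>, i.e. the one whose closure is cut out by the rank conditions. (Existence and uniqueness
  of such a \<open>P\<close> for restricted \<open>w\<close> are due to Brown, Goodearl and Yakimov. The orbits are locally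
  closed subvarieties, so their Euclidean and Zariski closures coincide.)
\<close>

definition is_leaf_orbit_of :: "nat \<Rightarrow> nat \<Rightarrow> (nat \<Rightarrow> nat) \<Rightarrow> complex mat set \<Rightarrow> bool" where
  "is_leaf_orbit_of m p w P \<longleftrightarrow>
    P \<in> leaf_orbits m p \<and> mat_topology m p closure_of P = rank_variety m p w"

end

theory Submission
  imports Defs
begin

text \<open>
  The closure of the orbit is the variety cut out by the rank conditions attached to \<open>w\<close>, so the
  question is which minors vanish on that variety. The answer goes through a system of
  inequalities, \<open>interval_bounds\<close>, that involves only \<open>w\<close> and the numbers of elements of
  \<open>I\<close> and \<open>\<Lambda>\<close> in intervals.

  If the minor is nonzero at some \<open>x\<close> in the variety, the inequalities hold: an invertible
  submatrix of size \<open>card I\<close> is covered by its rows outside a block, its columns outside the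
  block, and the part inside the block, whose rank is bounded (\<open>minor_nonzero_card_le\<close>).

  Conversely, if the inequalities hold, a single matrix shows that the minor does not vanish: the
  partial permutation matrix that matches \<open>I\<close> with \<open>\<Lambda>\<close> in increasing order. Its minor is
  \<open>1\<close>, and the rank of each of its relevant blocks is as small as the sizes of \<open>I\<close> and \<open>\<Lambda>\<close>
  permit (\<open>card_order_matching_box\<close>), so that the inequalities are just what is needed for it
  to lie in the variety.

  It remains to see that \<open>minor_family\<close> consists of the pairs that violate an inequality. For the
  two conditions on intervals this is a matter of counting, in which the bounds on \<open>w i - i\<close>
  reconcile the intervals used on both sides. The other two conditions rule out a set \<open>L\<close> lying
  between \<open>I\<close> and \<open>\<Lambda>\<close>, that is, a system of disjoint paths from \<open>\<Lambda>\<close> to \<open>I\<close> through the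
  entries \<open>1\<close> of a block of the permutation matrix. By a min-cut theorem (\<open>linking_iff\<close>) such a
  system exists if and only if no corner of the block yields a cut that is too small, and these are
  the remaining inequalities.
\<close>

section \<open>Rank and expansions into rank-one matrices\<close>

text \<open>
  Every expansion into rank-one summands bounds the rank from above, and
  \<open>mat_rank_decomposition\<close> provides one that attains it. Upper bounds for submatrices and sums
  then come from restricting and concatenating expansions.
\<close>

lemma mat_rank_le_card:
  fixes f :: "'k \<Rightarrow> nat \<Rightarrow> complex"
  assumes "finite K" and A: "A \<in> carrier_mat nr nc"
    and "\<And>i j. i < nr \<Longrightarrow> j < nc \<Longrightarrow> A $$ (i, j) = (\<Sum>k\<in>K. f k i * g k j)"
  shows "mat_rank A \<le> card K"
proof -
  interpret vec_space "TYPE(complex)" nr .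
  have "rank B \<le> card K"
    if "B \<in> carrier_mat nr nc" "\<And>i j. i < nr \<Longrightarrow> j < nc \<Longrightarrow> B $$ (i, j) = (\<Sum>k\<in>K. f k i * g k j)" for B
    using \<open>finite K\<close> that
  proof (induction K arbitrary: B rule: finite_induct)
    case empty
    then have "B = 0\<^sub>m nr nc" by auto
    then show ?case by (simp add: rank_0I)
  next
    case (insert k K)
    let ?C = "Matrix.mat nr nc (\<lambda>(i, j). f k i * g k j)"
    let ?D = "Matrix.mat nr nc (\<lambda>(i, j). \<Sum>k\<in>K. f k i * g k j)"
    have "B = ?C + ?D" using insert by (intro eq_matI) auto
    then have "rank B \<le> rank ?C + rank ?D" using rank_subadditive[of ?C nc ?D] by simp
    also have "rank ?C \<le> 1" by (rule rank_le_1_product_entries[where nc = nc]) auto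
    also have "rank ?D \<le> card K" by (rule insert.IH) auto
    finally show ?case using insert.hyps by simp
  qed
  from this[OF A assms(3)] show ?thesis using A unfolding mat_rank_def by auto
qed

text \<open>
  The summands are indexed by a maximal independent set of columns, in which all other columns
  are expanded.
\<close>

lemma mat_rank_decomposition:
  assumes A: "A \<in> carrier_mat nr nc"
  obtains K :: "complex vec set" and f g where "finite K" "card K = mat_rank A"
    "\<And>i j. i < nr \<Longrightarrow> j < nc \<Longrightarrow> A $$ (i, j) = (\<Sum>k\<in>K. f k i * g k j)"
proof -
  interpret vec_space "TYPE(complex)" nr .
  have cols: "set (cols A) \<subseteq> carrier_vec nr" using A cols_dim by blast
  obtain U where fU: "finite U" and U: "maximal U (\<lambda>T. T \<subseteq> set (cols A) \<and> lin_indpt T)"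
    using maximal_exists_superset[of "set (cols A)" "\<lambda>T. T \<subseteq> set (cols A) \<and> lin_indpt T" "{}"]
    by (auto simp: lin_dep_def)
  have Uc: "U \<subseteq> carrier_vec nr" and li: "lin_indpt U" and Us: "U \<subseteq> set (cols A)"
    using U cols unfolding maximal_def by auto
  have "\<exists>a. col A j = lincomb a U" if "j < nc" for j
  proof -
    have c: "col A j \<in> set (cols A)" using that A
      by (metis carrier_matD(2) cols_length cols_nth nth_mem)
    have "col A j \<in> span U"
    proof (rule ccontr)
      assume n: "col A j \<notin> span U"
      have "lin_indpt (U \<union> {col A j})"
        using lin_dep_iff_in_span[of U "col A j"] n Uc li c cols span_mem[of U] by auto
      moreover have "U \<union> {col A j} \<subseteq> set (cols A)" using c Us by simp
      ultimately have "U \<union> {col A j} = U" using U unfolding maximal_def by blast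
      then show False using n span_mem[OF Uc] by blast
    qed
    from finite_in_span[OF fU _ this] Uc obtain a where "lincomb a U = col A j" by auto
    then show ?thesis by (intro exI[of _ a]) simp
  qed
  then have "\<forall>j. \<exists>a. j < nc \<longrightarrow> col A j = lincomb a U" by simp
  from choice[OF this] obtain a where a: "\<And>j. j < nc \<Longrightarrow> col A j = lincomb (a j) U" by blast
  show ?thesis
  proof
    show "finite U" by fact
    show "card U = mat_rank A" using rank_card_indpt[OF A U] A unfolding mat_rank_def by auto
    fix i j assume ij: "i < nr" "j < nc"
    have "A $$ (i, j) = col A j $ i" using ij A by simp
    also have "\<dots> = (\<Sum>u\<in>U. a j u * u $ i)" using a[OF ij(2)] lincomb_index[OF ij(1) Uc] by simp
    finally show "A $$ (i, j) = (\<Sum>u\<in>U. (u $ i) * a j u)" by (simp add: mult.commute)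
  qed
qed

section \<open>Blocks and minors\<close>

lemma pick_interval:
  assumes "1 \<le> a" "i + a \<le> b"
  shows "pick {k. Suc k \<in> {a..b}} i = a - 1 + i"
proof -
  let ?S = "{k. Suc k \<in> {a..b}}"
  have "{x \<in> ?S. x < a - 1 + i} = {a - 1..<a - 1 + i}" using assms by auto
  then have "card {x \<in> ?S. x < a - 1 + i} = i" by simp
  moreover have "a - 1 + i \<in> ?S" using assms by auto
  ultimately show ?thesis using pick_card_in_set[of "a - 1 + i" ?S] by metis
qed

lemma block_eq:
  assumes "1 \<le> a" "b \<le> dim_row x" "1 \<le> c" "d \<le> dim_col x"
  shows "block x a b c d =
    Matrix.mat (b + 1 - a) (d + 1 - c) (\<lambda>(i, j). x $$ (a - 1 + i, c - 1 + j))"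
proof -
  have 1: "{i. i < dim_row x \<and> i \<in> {i. Suc i \<in> {a..b}}} = {a - 1..<b}" using assms by auto
  have 2: "{i. i < dim_col x \<and> i \<in> {i. Suc i \<in> {c..d}}} = {c - 1..<d}" using assms by auto
  show ?thesis unfolding block_def submatrix_def 1 2
    using assms
    by (intro eq_matI) (simp_all add: pick_interval del: atLeastAtMost_iff)
qed

section \<open>Ranks of blocks of partial permutation matrices\<close>

lemma mat_rank_ge_card_unit_cols:
  assumes A: "A \<in> carrier_mat nr nc" and J: "J \<subseteq> {..<nc}" and f: "inj_on f J"
    and "\<And>j. j \<in> J \<Longrightarrow> f j < nr" and "\<And>j. j \<in> J \<Longrightarrow> col A j = unit_vec nr (f j)"
  shows "card J \<le> mat_rank A"
proof -
  interpret vec_space "TYPE(complex)" nr .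
  let ?U = "(\<lambda>j. unit_vec nr (f j) :: complex vec) ` J"
  have "inj_on (\<lambda>j. unit_vec nr (f j) :: complex vec) J"
  proof (rule inj_onI)
    fix i j assume ij: "i \<in> J" "j \<in> J" and e: "unit_vec nr (f i) = (unit_vec nr (f j) :: complex vec)"
    have "f i = f j"
    proof (rule ccontr)
      assume "f i \<noteq> f j"
      then have "unit_vec nr (f i) $ f i \<noteq> (unit_vec nr (f j) $ f i :: complex)"
        using assms(4) ij by simp
      then show False using e by simp
    qed
    then show "i = j" using f ij by (auto dest: inj_onD)
  qed
  then have "card J = card ?U" by (simp add: card_image)
  also have "\<dots> \<le> rank A"
  proof (rule rank_ge_card_indpt[OF A])
    show "?U \<subseteq> set (cols A)" using assms(5) J A
      by (smt (verit, ccfv_threshold) carrier_matD(2) cols_length cols_nth image_subsetI lessThan_iff nth_mem subset_iff)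
    have "?U \<subseteq> set (unit_vecs nr)" using assms(4) by (auto simp: unit_vecs_def)
    then show "lin_indpt ?U" using unit_vecs_basis subset_li_is_li unfolding basis_def by blast
  qed
  finally show ?thesis using A unfolding mat_rank_def by auto
qed

text \<open>
  The positions in \<open>S\<close> are 1-based, like the index sets of minors and blocks.
\<close>

definition dot_matrix :: "nat \<Rightarrow> nat \<Rightarrow> (nat \<times> nat) set \<Rightarrow> complex mat" where
  "dot_matrix m p S = Matrix.mat m p (\<lambda>(i, j). of_bool ((Suc i, Suc j) \<in> S))"

text \<open>
  The hypotheses say that \<open>S\<close> has at most one dot in each row and column. Each dot is a
  rank-one matrix, which gives the upper bound; the columns that contain a dot are distinct
  unit vectors, which gives the lower one.
\<close>

lemma mat_rank_block_dot_matrix: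
  assumes inj: "inj_on fst S" "inj_on snd S"
    and "1 \<le> a" "b \<le> m" "1 \<le> c" "d \<le> p"
  shows "mat_rank (block (dot_matrix m p S) a b c d) = card (S \<inter> {a..b} \<times> {c..d})"
proof -
  let ?T = "S \<inter> {a..b} \<times> {c..d}" and ?B = "block (dot_matrix m p S) a b c d"
  have fT: "finite ?T" by (rule finite_subset[of _ "{a..b} \<times> {c..d}"]) auto
  have B: "?B = Matrix.mat (b + 1 - a) (d + 1 - c) (\<lambda>(i, j). of_bool ((a + i, c + j) \<in> S))"
    using assms by (subst block_eq) (auto simp: dot_matrix_def intro!: eq_matI)
  have Bc: "?B \<in> carrier_mat (b + 1 - a) (d + 1 - c)" unfolding B by simp
  have "mat_rank ?B \<le> card ?T"
  proof (rule mat_rank_le_card[OF fT Bc,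
        where f = "\<lambda>t i. of_bool (fst t = a + i)" and g = "\<lambda>t j. of_bool (snd t = c + j)"])
    fix i j assume ij: "i < b + 1 - a" "j < d + 1 - c"
    have "(\<Sum>t\<in>?T. of_bool (fst t = a + i) * of_bool (snd t = c + j))
        = (\<Sum>t\<in>?T. if t = (a + i, c + j) then 1 else (0::complex))"
      by (rule sum.cong) (auto simp: prod_eq_iff)
    also have "\<dots> = of_bool ((a + i, c + j) \<in> S)" using ij fT by (auto simp: sum.delta)
    finally show "?B $$ (i, j) = (\<Sum>t\<in>?T. of_bool (fst t = a + i) * of_bool (snd t = c + j))"
      using ij unfolding B by simp
  qed
  moreover have "card ?T \<le> mat_rank ?B"
  proof -
    let ?J = "(\<lambda>t. snd t - c) ` ?T"
    have col: "\<exists>i. i < b + 1 - a \<and> (a + i, c + j) \<in> S" if j: "j \<in> ?J" for j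
    proof -
      obtain k l where "(k, l) \<in> ?T" "j = l - c" using j by force
      then show ?thesis by (intro exI[of _ "k - a"]) auto
    qed
    then obtain f where f: "\<And>j. j \<in> ?J \<Longrightarrow> f j < b + 1 - a \<and> (a + f j, c + j) \<in> S" by metis
    have "inj_on (\<lambda>t. snd t - c) ?T"
    proof (rule inj_onI)
      fix t t' assume t: "t \<in> ?T" "t' \<in> ?T" and e: "snd t - c = snd t' - c"
      then have "c \<le> snd t" "c \<le> snd t'" by auto
      then have "snd t = snd t'" using e by linarith
      then show "t = t'" using inj(2) t by (auto dest: inj_onD)
    qed
    then have "card ?T = card ?J" by (simp add: card_image)
    also have "\<dots> \<le> mat_rank ?B"
    proof (rule mat_rank_ge_card_unit_cols[OF Bc, of ?J f])
      show J: "?J \<subseteq> {..<d + 1 - c}" by auto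
      show "inj_on f ?J"
      proof (rule inj_onI)
        fix i j assume "i \<in> ?J" "j \<in> ?J" "f i = f j"
        then show "i = j" using f[of i] f[of j] inj_onD[OF inj(1), of "(a + f i, c + i)" "(a + f j, c + j)"] by auto
      qed
      show "f j < b + 1 - a" if "j \<in> ?J" for j using f[OF that] by simp
      show "col ?B j = unit_vec (b + 1 - a) (f j)" if j: "j \<in> ?J" for j
      proof (rule eq_vecI)
        fix i assume "i < dim_vec (unit_vec (b + 1 - a) (f j))"
        then have i: "i < b + 1 - a" by simp
        have "j < d + 1 - c" using J j by blast
        moreover have "(a + i, c + j) \<in> S \<longleftrightarrow> i = f j"
          using f[OF j] inj_onD[OF inj(2), of "(a + i, c + j)" "(a + f j, c + j)"] by auto
        ultimately show "col ?B j $ i = unit_vec (b + 1 - a) (f j) $ i"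
          using i f[OF j] unfolding B by simp
      qed (simp add: B)
    qed
    finally show ?thesis .
  qed
  ultimately show ?thesis by simp
qed

lemma card_shifted:
  fixes I :: "nat set"
  assumes "I \<subseteq> {1..m}"
  shows "card {i. i < m \<and> i \<in> {i. Suc i \<in> I}} = card I"
proof -
  have "I = Suc ` {i. i < m \<and> i \<in> {i. Suc i \<in> I}}"
  proof
    show "I \<subseteq> Suc ` {i. i < m \<and> i \<in> {i. Suc i \<in> I}}"
    proof
      fix x assume x: "x \<in> I"
      then have "x \<ge> 1" "x \<le> m" using assms by auto
      then show "x \<in> Suc ` {i. i < m \<and> i \<in> {i. Suc i \<in> I}}" using x
        by (intro image_eqI[of _ _ "x - 1"]) auto
    qed
  qed auto
  from arg_cong[OF this, of card] show ?thesis by (simp add: card_image)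
qed

lemma pick_shifted:
  assumes "I \<subseteq> {1..m}" "a < card I"
  shows "Suc (pick {i. Suc i \<in> I} a) \<in> I" "pick {i. Suc i \<in> I} a < m"
    "card {i \<in> {i. Suc i \<in> I}. i < pick {i. Suc i \<in> I} a} = a"
proof -
  let ?S = "{i. Suc i \<in> I}"
  have "card ?S = card I"
  proof -
    have "?S = {i. i < m \<and> i \<in> {i. Suc i \<in> I}}" using assms by (auto dest: subsetD)
    then show ?thesis using card_shifted[OF assms(1)] by simp
  qed
  then have a: "a < card ?S" using assms by simp
  show s: "Suc (pick ?S a) \<in> I" using pick_in_set_le[OF a] by simp
  then show "pick ?S a < m" using assms(1) by auto
  show "card {i \<in> ?S. i < pick ?S a} = a" by (rule card_pick_le[OF a])
qed

text \<open>
  The submatrix on rows \<open>I\<close> and columns \<open>\<Lambda>\<close> is invertible, so its rank is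
  \<open>card I\<close>. It is the sum of three parts: the rows outside \<open>{a..b}\<close>, one summand
  per row; what remains of the columns outside \<open>{c..d}\<close>, one summand per column; and a
  submatrix of the block. A nonzero minor therefore forces a lower bound on the rank of every block.
\<close>

lemma minor_nonzero_card_le:
  assumes x: "x \<in> carrier_mat m p" and I: "I \<subseteq> {1..m}" and \<Lambda>: "\<Lambda> \<subseteq> {1..p}"
    and card: "card I = card \<Lambda>" and nz: "minor I \<Lambda> x \<noteq> 0"
    and "1 \<le> a" "b \<le> m" "1 \<le> c" "d \<le> p"
  shows "card I \<le> card (I - {a..b}) + card (\<Lambda> - {c..d}) + mat_rank (block x a b c d)"
proof -
  have fin: "finite I" "finite \<Lambda>" using I \<Lambda> finite_subset by blast+
  let ?I = "{i. Suc i \<in> I}" and ?L = "{i. Suc i \<in> \<Lambda>}"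
  define k where "k = card I"
  define B where "B = submatrix x ?I ?L"
  define u where "u i = Suc (pick ?I i)" for i
  define v where "v j = Suc (pick ?L j)" for j
  have u: "u i \<in> I" if "i < k" for i using pick_shifted(1)[OF I] that unfolding u_def k_def by simp
  have v: "v j \<in> \<Lambda>" if "j < k" for j using pick_shifted(1)[OF \<Lambda>] that unfolding v_def k_def card by simp
  have B: "B \<in> carrier_mat k k" using x card_shifted[OF I] card_shifted[OF \<Lambda>] card
    unfolding B_def k_def by (auto simp: dim_submatrix)
  have Bij: "B $$ (i, j) = x $$ (u i - 1, v j - 1)" if "i < k" "j < k" for i j
    using that x card_shifted[OF I] card_shifted[OF \<Lambda>] card unfolding B_def u_def v_def k_def
    by (subst submatrix_index) auto
  have "k = mat_rank B" using vec_space.low_rank_det_zero[OF B] nz B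
    unfolding mat_rank_def minor_def B_def by auto
  also obtain K :: "complex vec set" and f g where K: "finite K" "card K = mat_rank (block x a b c d)"
    and fg: "\<And>i j. i < b + 1 - a \<Longrightarrow> j < d + 1 - c \<Longrightarrow>
               block x a b c d $$ (i, j) = (\<Sum>k\<in>K. f k i * g k j)"
    using assms by (elim mat_rank_decomposition[of "block x a b c d" "b + 1 - a" "d + 1 - c", rotated])
      (auto simp: block_eq)
  have "mat_rank B \<le> card ((I - {a..b}) <+> ((\<Lambda> - {c..d}) <+> K))"
  proof (rule mat_rank_le_card[OF _ B])
    let ?F = "case_sum (\<lambda>i' i. of_bool (u i = i'))
      (case_sum (\<lambda>j' i. if u i \<in> {a..b} then x $$ (u i - 1, j' - 1) else 0)
        (\<lambda>l i. if u i \<in> {a..b} then f l (u i - a) else 0))"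
    let ?G = "case_sum (\<lambda>i' j. x $$ (i' - 1, v j - 1))
      (case_sum (\<lambda>j' j. of_bool (v j = j'))
        (\<lambda>l j. if v j \<in> {c..d} then g l (v j - c) else 0))"
    show "finite ((I - {a..b}) <+> ((\<Lambda> - {c..d}) <+> K))" using fin K by simp
    fix i j assume ij: "i < k" "j < k"
    have 1: "(\<Sum>i'\<in>I - {a..b}. of_bool (u i = i') * x $$ (i' - 1, v j - 1))
        = (if u i \<in> {a..b} then 0 else x $$ (u i - 1, v j - 1))"
    proof -
      have "(\<Sum>i'\<in>I - {a..b}. of_bool (u i = i') * x $$ (i' - 1, v j - 1))
         = (\<Sum>i'\<in>I - {a..b}. if i' = u i then x $$ (i' - 1, v j - 1) else 0)"
        by (rule sum.cong) auto
      then show ?thesis using u[OF ij(1)] fin by (auto simp: sum.delta)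
    qed
    have 2: "(\<Sum>j'\<in>\<Lambda> - {c..d}. x $$ (u i - 1, j' - 1) * of_bool (v j = j'))
        = (if v j \<in> {c..d} then 0 else x $$ (u i - 1, v j - 1))"
    proof -
      have "(\<Sum>j'\<in>\<Lambda> - {c..d}. x $$ (u i - 1, j' - 1) * of_bool (v j = j'))
         = (\<Sum>j'\<in>\<Lambda> - {c..d}. if j' = v j then x $$ (u i - 1, j' - 1) else 0)"
        by (rule sum.cong) auto
      then show ?thesis using v[OF ij(2)] fin by (auto simp: sum.delta)
    qed
    have 3: "(\<Sum>l\<in>K. f l (u i - a) * g l (v j - c)) = x $$ (u i - 1, v j - 1)"
      if "u i \<in> {a..b}" "v j \<in> {c..d}"
    proof -
      have "u i - a < b + 1 - a" "v j - c < d + 1 - c" using that by auto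
      from fg[OF this] show ?thesis using that x assms by (auto simp: block_eq)
    qed
    have "(\<Sum>t\<in>(I - {a..b}) <+> ((\<Lambda> - {c..d}) <+> K). ?F t i * ?G t j)
       = (\<Sum>i'\<in>I - {a..b}. of_bool (u i = i') * x $$ (i' - 1, v j - 1))
        + ((\<Sum>j'\<in>\<Lambda> - {c..d}. (if u i \<in> {a..b} then x $$ (u i - 1, j' - 1) else 0) * of_bool (v j = j'))
        + (\<Sum>l\<in>K. (if u i \<in> {a..b} then f l (u i - a) else 0) * (if v j \<in> {c..d} then g l (v j - c) else 0)))"
      using fin K by (simp add: sum.Plus)
    also have "\<dots> = x $$ (u i - 1, v j - 1)"
      using 1 2 3
      by (cases "u i \<in> {a..b}"; cases "v j \<in> {c..d}")
        (simp_all only: if_True if_False mult_zero_left mult_zero_right sum.neutral_const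
          add_0_left add_0_right HOL.simp_thms)
    finally show "B $$ (i, j) = (\<Sum>t\<in>(I - {a..b}) <+> ((\<Lambda> - {c..d}) <+> K). ?F t i * ?G t j)"
      using Bij ij by simp
  qed
  also have "\<dots> = card (I - {a..b}) + (card (\<Lambda> - {c..d}) + card K)"
    using fin K by (simp add: card_Plus)
  finally show ?thesis using K k_def by simp
qed

section \<open>The order on index sets and linkings\<close>

lemma sorted_list_of_set_nth_less_iff:
  fixes I :: "nat set"
  assumes "finite I" "l < card I"
  shows "sorted_list_of_set I ! l < s \<longleftrightarrow> l < card (I \<inter> {..<s})"
proof -
  let ?xs = "sorted_list_of_set I"
  let ?K = "{k. k < card I \<and> ?xs ! k < s}"
  have bij: "bij_betw ((!) ?xs) {..<card I} I"
    using assms(1) by (intro bij_betw_nth) auto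
  have im: "(!) ?xs ` ?K = I \<inter> {..<s}"
    using bij unfolding bij_betw_def by auto
  have "inj_on ((!) ?xs) ?K"
    using bij unfolding bij_betw_def by (auto intro: inj_on_subset)
  from card_image[OF this] have c: "card (I \<inter> {..<s}) = card ?K" unfolding im .
  have mono: "?xs ! i \<le> ?xs ! j" if "i \<le> j" "j < card I" for i j
    using that assms(1) by (intro sorted_nth_mono) auto
  show ?thesis
  proof
    assume "?xs ! l < s"
    then have "{..l} \<subseteq> ?K" using assms(2) mono by (auto intro: le_less_trans)
    then have "card {..l} \<le> card ?K" by (intro card_mono) auto
    then show "l < card (I \<inter> {..<s})" using c by simp
  next
    assume l: "l < card (I \<inter> {..<s})"
    show "?xs ! l < s"
    proof (rule ccontr)
      assume "\<not> ?xs ! l < s"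
      then have "?K \<subseteq> {..<l}" using mono by (auto simp: not_less) (meson le_less_trans not_le)
      then have "card ?K \<le> card {..<l}" by (intro card_mono) auto
      then show False using l c by simp
    qed
  qed
qed

text \<open>
  Comparing the sorted lists entry by entry amounts to comparing counting functions. In this form
  the order can be handled by counting, without any reference to lists.
\<close>

lemma set_le_iff_card:
  assumes "finite I" "finite J"
  shows "set_le I J \<longleftrightarrow> card I = card J \<and> (\<forall>s. card (J \<inter> {..<s}) \<le> card (I \<inter> {..<s}))"
proof (cases "card I = card J")
  case True
  note I = sorted_list_of_set_nth_less_iff[OF assms(1)]
    and J = sorted_list_of_set_nth_less_iff[OF assms(2)]
  show ?thesis
  proof
    assume le: "set_le I J"
    have "card (J \<inter> {..<s}) \<le> card (I \<inter> {..<s})" for s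
    proof (rule ccontr)
      assume n: "\<not> ?thesis"
      define l where "l = card (I \<inter> {..<s})"
      have l: "l < card (J \<inter> {..<s})" using n l_def by simp
      also have "\<dots> \<le> card J" using assms by (intro card_mono) auto
      finally have "l < card J" .
      then have "sorted_list_of_set J ! l < s" "sorted_list_of_set I ! l \<le> sorted_list_of_set J ! l"
        using J l le True unfolding set_le_def by auto
      then show False using I[of l s] \<open>l < card J\<close> True l_def by simp
    qed
    then show "card I = card J \<and> (\<forall>s. card (J \<inter> {..<s}) \<le> card (I \<inter> {..<s}))" using True by simp
  next
    assume le: "card I = card J \<and> (\<forall>s. card (J \<inter> {..<s}) \<le> card (I \<inter> {..<s}))"
    have "sorted_list_of_set I ! l \<le> sorted_list_of_set J ! l" if "l < card I" for l
    proof -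
      let ?s = "Suc (sorted_list_of_set J ! l)"
      have "l < card (J \<inter> {..<?s})" using J[of l ?s] that True by simp
      then have "l < card (I \<inter> {..<?s})" using le less_le_trans by blast
      then show ?thesis using I[of l ?s] that by simp
    qed
    then show "set_le I J" using True unfolding set_le_def by simp
  qed
qed (simp add: set_le_def)

lemma card_Collect_remove:
  assumes "finite X" "x \<in> X"
  shows "card {y \<in> X. P y} = card {y \<in> X - {x}. P y} + of_bool (P x)"
proof (cases "P x")
  case True
  then have "{y \<in> X. P y} = insert x {y \<in> X - {x}. P y}" using assms by auto
  then show ?thesis using assms True by simp
next
  case False
  then have "{y \<in> X. P y} = {y \<in> X - {x}. P y}" by auto
  then show ?thesis using False by simp
qed

text \<open>
  A min-cut theorem. Call \<open>d \<in> D\<close> a dot with column \<open>d\<close> and row \<open>u d\<close>; each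
  \<open>a \<in> A\<close> is to be joined, through a dot of its own, to a \<open>b \<in> B\<close> of its own, with
  \<open>d \<le> a\<close> and \<open>b \<le> u d\<close>. The hypothesis says that no cut given by a pair of thresholds
  is smaller than \<open>card A\<close>. A greedy choice works: serve the least element \<open>a\<close> of
  \<open>A\<close> by any dot \<open>d\<close> that reaches some element of \<open>B\<close>, and let that dot absorb the largest
  \<open>b \<in> B\<close> that it reaches. After deleting \<open>a\<close>, \<open>b\<close> and \<open>d\<close> the hypothesis persists. The
  conclusion expresses the relations between \<open>A\<close>, \<open>L\<close> and \<open>B\<close> by counting.
\<close>

lemma linking_exists:
  fixes A B D :: "nat set" and u :: "nat \<Rightarrow> nat"
  assumes "finite A" "finite B" "finite D" "card A = card B"
    and "\<And>r s. card {a \<in> A. a < s} \<le> card {b \<in> B. b < r} + card {d \<in> D. d < s \<and> r \<le> u d}"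
  shows "\<exists>L\<subseteq>D. card L = card A \<and> (\<forall>s. card {a \<in> A. a < s} \<le> card {d \<in> L. d < s}) \<and>
     (\<forall>r. card {d \<in> L. u d < r} \<le> card {b \<in> B. b < r})"
  using assms
proof (induction "card A" arbitrary: A B D)
  case 0
  then show ?case by (intro exI[of _ "{}"]) auto
next
  case (Suc n)
  define a where "a = Min A"
  have ne: "A \<noteq> {}" "B \<noteq> {}" using Suc.hyps(2) Suc.prems(4) by auto
  have a: "a \<in> A" and amin: "\<And>x. x \<in> A \<Longrightarrow> a \<le> x" unfolding a_def using ne Suc.prems by auto
  have "{x \<in> A. x < Suc a} = {a}" using a amin by (auto simp: less_Suc_eq_le intro: antisym)
  then have "card {x \<in> A. x < Suc a} = 1" by simp
  moreover have "card {b \<in> B. b < Min B} = 0" using Suc.prems(2) by (simp add: not_less)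
  ultimately have "1 \<le> card {d \<in> D. d < Suc a \<and> Min B \<le> u d}"
    using Suc.prems(5)[of "Suc a" "Min B"] by linarith
  then obtain d where d: "d \<in> D" "d \<le> a" "Min B \<le> u d"
    by (metis (mono_tags, lifting) Collect_empty_eq card.empty less_Suc_eq_le not_one_le_zero)
  define b where "b = Max {b \<in> B. b \<le> u d}"
  have "{b \<in> B. b \<le> u d} \<noteq> {}" using d(3) ne Suc.prems(2) Min_in by blast
  then have b: "b \<in> B" "b \<le> u d" and bmax: "\<And>x. x \<in> B \<Longrightarrow> x \<le> u d \<Longrightarrow> x \<le> b"
    using Max_in[of "{b \<in> B. b \<le> u d}"] Suc.prems(2) unfolding b_def by auto
  let ?A = "A - {a}" and ?B = "B - {b}" and ?D = "D - {d}"
  have "\<exists>L\<subseteq>?D. card L = card ?A \<and> (\<forall>s. card {a \<in> ?A. a < s} \<le> card {d \<in> L. d < s}) \<and>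
     (\<forall>r. card {d \<in> L. u d < r} \<le> card {b \<in> ?B. b < r})"
  proof (rule Suc.hyps(1))
    show "n = card ?A" "card ?A = card ?B" using Suc.hyps(2) Suc.prems a b by auto
    fix r s :: nat
    let ?DD = "\<lambda>D r. card {d \<in> D. d < s \<and> r \<le> u d}"
    note cA = card_Collect_remove[OF Suc.prems(1) a, of "\<lambda>x. x < s"]
      and cB = card_Collect_remove[OF Suc.prems(2) b(1), of "\<lambda>x. x < r"]
      and cD = card_Collect_remove[OF Suc.prems(3) d(1), of "\<lambda>x. x < s \<and> r \<le> u x"]
    show "card {a \<in> ?A. a < s} \<le> card {b \<in> ?B. b < r} + ?DD ?D r"
    proof (cases "a < s")
      case False
      then have "\<not> x < s" if "x \<in> ?A" for x using amin[of x] that by simp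
      then have "{a \<in> ?A. a < s} = {}" by blast
      then show ?thesis by (metis card.empty le0)
    next
      case True
      show ?thesis
      proof (cases "b < r \<and> r \<le> u d")
        case False
        then show ?thesis using cA cB cD True le_less_trans[OF d(2) True] Suc.prems(5)[of s r] b(2) by (auto split: if_splits)
      next
        case both: True
        \<comment> \<open>Deleting \<open>b\<close> and \<open>d\<close> costs the right-hand side two, while the left-hand side drops by one
          only, so the hypothesis has to be sharpened by one. Raising the threshold
          to just above \<open>u d\<close> loses no element of \<open>B\<close>, because the largest one up to \<open>u d\<close> is
          \<open>b < r\<close>, but it discards the dot \<open>d\<close>.\<close>
        have "{b \<in> B. b < Suc (u d)} = {b \<in> B. b < r}" using bmax both by (auto simp: less_Suc_eq_le) (meson le_less_trans)
        moreover have "?DD D (Suc (u d)) \<le> ?DD ?D r"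
          using Suc.prems(3) both by (intro card_mono) auto
        ultimately have "card {a \<in> A. a < s} \<le> card {b \<in> B. b < r} + ?DD ?D r"
          using Suc.prems(5)[of s "Suc (u d)"] by simp
        then show ?thesis using cA cB True both by simp
      qed
    qed
  qed (use Suc.prems in auto)
  then obtain L where L: "L \<subseteq> ?D" "card L = card ?A"
    "\<And>s. card {a \<in> ?A. a < s} \<le> card {d \<in> L. d < s}"
    "\<And>r. card {d \<in> L. u d < r} \<le> card {b \<in> ?B. b < r}" by blast
  have fL: "finite (insert d L)" and dL: "d \<notin> L" using L(1) Suc.prems(3) finite_subset by auto
  then have ins: "insert d L - {d} = L" by simp
  show ?case
  proof (intro exI[of _ "insert d L"] conjI allI)
    show "insert d L \<subseteq> D" using L d by auto
    show "card (insert d L) = card A" using fL dL L(2) a Suc.prems(1) Suc.hyps(2) by simp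
    show "card {a \<in> A. a < s} \<le> card {x \<in> insert d L. x < s}" for s
      using card_Collect_remove[OF Suc.prems(1) a, of "\<lambda>x. x < s"] L(3)[of s] d(2)
        card_Collect_remove[OF fL insertI1, of "\<lambda>x. x < s"] unfolding ins by (auto split: if_splits)
    show "card {x \<in> insert d L. u x < r} \<le> card {b \<in> B. b < r}" for r
      using card_Collect_remove[OF Suc.prems(2) b(1), of "\<lambda>x. x < r"] L(4)[of r] b(2)
        card_Collect_remove[OF fL insertI1, of "\<lambda>x. u x < r"] unfolding ins by (auto split: if_splits)
  qed
qed

text \<open>
  The easy half of the min-cut theorem: the dots of \<open>L\<close> left of \<open>s\<close> either have a row less than
  \<open>r\<close>, where \<open>B\<close> leaves room for few of them, or are counted in the last summand.
\<close>

lemma linking_bound: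
  fixes A B D L :: "nat set" and u :: "nat \<Rightarrow> nat"
  assumes "finite D" "finite B" "L \<subseteq> D" "card L = card B"
    and A: "card {a \<in> A. a < s} \<le> card {d \<in> L. d < s}"
    and B: "card {d \<in> L. u d < r} \<le> card {b \<in> B. b < r}"
  shows "card {a \<in> A. a < s} \<le> card {b \<in> B. b < r} + card {d \<in> D. d < s \<and> r \<le> u d}"
proof -
  have "{d \<in> L. d < s} \<subseteq> {d \<in> L. u d < r} \<union> {d \<in> D. d < s \<and> r \<le> u d}" using assms(3) by auto
  then have "card {d \<in> L. d < s} \<le> card ({d \<in> L. u d < r} \<union> {d \<in> D. d < s \<and> r \<le> u d})"
    using assms(1) finite_subset[OF assms(3,1)] by (intro card_mono) auto
  also have "\<dots> \<le> card {d \<in> L. u d < r} + card {d \<in> D. d < s \<and> r \<le> u d}" by (rule card_Un_le)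
  finally show ?thesis using A B by simp
qed

text \<open>
  Both halves together, with the thresholds cut down to the ranges in which \<open>A\<close> and \<open>B\<close>
  live: outside these ranges the inequality is either trivial or an instance of one inside.
\<close>

lemma linking_iff:
  fixes A B D :: "nat set" and u :: "nat \<Rightarrow> nat"
  assumes "finite D" and u: "inj_on u D" "u ` D \<subseteq> {lo..hi}"
    and A: "A \<subseteq> {1..n}" and B: "B \<subseteq> {lo..hi}" and "card A = card B" "1 \<le> n" "lo \<le> hi" "D \<subseteq> {1..n}"
  shows "(\<exists>L. L \<subseteq> D \<and> card L = card A \<and> set_le L A \<and> set_le B (u ` L)) \<longleftrightarrow>
    (\<forall>r\<in>{lo..hi}. \<forall>s\<in>{1..n}.
       card (A \<inter> {1..s}) \<le> card (B \<inter> {lo..<r}) + card {d \<in> D. d \<le> s \<and> r \<le> u d})"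
    (is "?L \<longleftrightarrow> ?R")
proof -
  have fin: "finite A" "finite B" using A B finite_subset by blast+
  let ?ineq = "\<lambda>r s. card {a \<in> A. a < s} \<le> card {b \<in> B. b < r} + card {d \<in> D. d < s \<and> r \<le> u d}"
  have As: "{a \<in> A. a < Suc s} = A \<inter> {1..s}" for s using A by auto
  have Br: "{b \<in> B. b < r} = B \<inter> {lo..<r}" for r using B by auto
  have "?L \<longleftrightarrow> (\<forall>r s. ?ineq r s)"
  proof
    assume ?L
    then obtain L where L: "L \<subseteq> D" "card L = card A" "set_le L A" "set_le B (u ` L)" by blast
    have fL: "finite L" using L(1) assms(1) finite_subset by blast
    have "card {a \<in> A. a < s} \<le> card {d \<in> L. d < s}" for s
      using L(3) set_le_iff_card[OF fL fin(1)] by (simp add: Int_def)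
    moreover have "card {d \<in> L. u d < r} \<le> card {b \<in> B. b < r}" for r
    proof -
      have im: "u ` {d \<in> L. u d < r} = u ` L \<inter> {..<r}" by auto
      have "inj_on u {d \<in> L. u d < r}" using u(1) L(1) by (auto intro: inj_on_subset)
      from card_image[OF this] have "card {d \<in> L. u d < r} = card (u ` L \<inter> {..<r})" unfolding im ..
      also have "\<dots> \<le> card (B \<inter> {..<r})" using L(4) set_le_iff_card[of B "u ` L"] fin fL by simp
      finally show ?thesis by (simp add: Int_def)
    qed
    ultimately show "\<forall>r s. ?ineq r s" using linking_bound[of D B L A] assms(1,6) fin L by auto
  next
    assume "\<forall>r s. ?ineq r s"
    then obtain L where L: "L \<subseteq> D" "card L = card A" "\<And>s. card {a \<in> A. a < s} \<le> card {d \<in> L. d < s}"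
      "\<And>r. card {d \<in> L. u d < r} \<le> card {b \<in> B. b < r}"
      using linking_exists[of A B D u] fin assms by auto
    have fL: "finite L" using L(1) assms(1) finite_subset by blast
    have inj: "inj_on u L" using u(1) L(1) inj_on_subset by blast
    have "set_le L A" using set_le_iff_card[OF fL fin(1)] L by (simp add: Int_def)
    moreover have "card (u ` L \<inter> {..<r}) \<le> card (B \<inter> {..<r})" for r
    proof -
      have "u ` L \<inter> {..<r} = u ` {d \<in> L. u d < r}" by auto
      then have "card (u ` L \<inter> {..<r}) \<le> card {d \<in> L. u d < r}" using fL by (simp add: card_image_le)
      then show ?thesis using L(4)[of r] by (simp add: Int_def)
    qed
    then have "set_le B (u ` L)" using set_le_iff_card[of B "u ` L"] fin fL inj L(2) assms(6)
      by (simp add: card_image)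
    ultimately show ?L using L by blast
  qed
  also have "\<dots> \<longleftrightarrow> ?R"
  proof
    assume ineq: "\<forall>r s. ?ineq r s"
    show ?R
    proof (intro ballI)
      fix r s
      show "card (A \<inter> {1..s}) \<le> card (B \<inter> {lo..<r}) + card {d \<in> D. d \<le> s \<and> r \<le> u d}"
        using ineq[rule_format, of "Suc s" r] unfolding As Br by (simp add: less_Suc_eq_le)
    qed
  next
    assume R: ?R
    show "\<forall>r s. ?ineq r s"
    proof (intro allI)
      fix r s :: nat
      consider "s \<le> 1" | "hi < r" | "1 < s" "r \<le> hi" by linarith
      then show "?ineq r s"
      proof cases
        case 1
        then have "{a \<in> A. a < s} = {}" using A by auto
        then show ?thesis by (metis card.empty le0)
      next
        case 2
        then have "{b \<in> B. b < r} = B" using B by auto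
        moreover have "card {a \<in> A. a < s} \<le> card A" using fin by (intro card_mono) auto
        ultimately show ?thesis using assms(6) by simp
      next
        case 3
        let ?r = "max r lo" and ?s = "min (s - 1) n"
        have "card (A \<inter> {1..?s}) \<le> card (B \<inter> {lo..<?r}) + card {d \<in> D. d \<le> ?s \<and> ?r \<le> u d}"
        proof -
          have "?r \<in> {lo..hi}" "?s \<in> {1..n}" using 3 assms(7,8) by auto
          then show ?thesis using R by blast
        qed
        moreover have "A \<inter> {1..?s} = {a \<in> A. a < s}" using A 3 by auto
        moreover have "B \<inter> {lo..<?r} = {b \<in> B. b < r}" using B by auto
        moreover have "{d \<in> D. d \<le> ?s \<and> ?r \<le> u d} = {d \<in> D. d < s \<and> r \<le> u d}"
          using u(2) 3 assms(9) by auto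
        ultimately show ?thesis by simp
      qed
    qed
  qed
  finally show ?thesis .
qed

section \<open>The families of minors as interval inequalities\<close>

text \<open>
  Put \<open>x\<close> next to an antidiagonal identity matrix of size \<open>m\<close>. Then \<open>[I|\<Lambda>](x)\<close> is, up to
  sign, the maximal minor of this \<open>m \<times> (m + p)\<close> matrix whose columns are \<open>\<Lambda>\<close> and
  the unit columns that belong to the complement of \<open>I\<close>. The four inequalities say that no
  interval in the cyclic order of the columns contains more of the selected columns than the rank
  bound attached to \<open>w\<close> permits: intervals that start or end among the unit columns on either
  side of \<open>x\<close>, intervals inside \<open>x\<close>, and intervals that contain all of \<open>x\<close>.
\<close>

definition interval_bounds :: "nat \<Rightarrow> nat \<Rightarrow> (nat \<Rightarrow> nat) \<Rightarrow> nat set \<Rightarrow> nat set \<Rightarrow> bool" where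
  "interval_bounds m p w I \<Lambda> \<longleftrightarrow>
    (\<forall>r\<in>{1..m}. \<forall>s\<in>{1..p}.
       card (\<Lambda> \<inter> {1..s}) \<le> card (I \<inter> {1..<r}) + card {j \<in> {1..s}. w j \<le> m + 1 - r}) \<and>
    (\<forall>r\<in>{1..m}. \<forall>s\<in>{1..p}.
       card (I \<inter> {1..r}) \<le> card (\<Lambda> \<inter> {1..<s}) + card {i \<in> {1..r}. m + s \<le> w (m + p + 1 - i)}) \<and>
    (\<forall>r s. 1 \<le> r \<and> r \<le> s \<and> s \<le> p \<longrightarrow>
       card (\<Lambda> \<inter> {r..s}) + card {j \<in> {r..s}. m + r \<le> w j} \<le> s + 1 - r) \<and>
    (\<forall>r s. 1 \<le> r \<and> r \<le> s \<and> s \<le> m \<longrightarrow>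
       card (I \<inter> {r..s}) + card {j \<in> {1..s}. w (m + p + 1 - j) \<in> {m + 1 - s..m + 1 - r}} \<le> s + 1 - r)"

lemma restricted_permsD:
  assumes "w \<in> restricted_perms m p"
  shows "bij w" "1 \<le> i \<Longrightarrow> i \<le> m + p \<Longrightarrow> 1 \<le> w i \<and> w i \<le> m + p"
    "1 \<le> i \<Longrightarrow> i \<le> m + p \<Longrightarrow> i \<le> w i + p" "1 \<le> i \<Longrightarrow> i \<le> m + p \<Longrightarrow> w i \<le> i + m"
    "w i = w j \<longleftrightarrow> i = j" "inv_into UNIV w ` X = {j. w j \<in> X}"
    "1 \<le> w i \<Longrightarrow> w i \<le> m + p \<Longrightarrow> 1 \<le> i \<and> i \<le> m + p"
proof -
  have w: "w permutes {1..m + p}" using assms unfolding restricted_perms_def by simp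
  show bij: "bij w" using w permutes_bij by blast
  show "w i = w j \<longleftrightarrow> i = j" using bij by (metis bij_pointE)
  show "inv_into UNIV w ` X = {j. w j \<in> X}" using bij_vimage_eq_inv_image[OF bij, of X] by auto
  show "1 \<le> i \<Longrightarrow> i \<le> m + p \<Longrightarrow> 1 \<le> w i \<and> w i \<le> m + p" using permutes_in_image[OF w, of i] by auto
  show "1 \<le> w i \<Longrightarrow> w i \<le> m + p \<Longrightarrow> 1 \<le> i \<and> i \<le> m + p" using permutes_in_image[OF w, of i] by auto
  show "i \<le> w i + p" if "1 \<le> i" "i \<le> m + p"
  proof -
    have "- int p \<le> int (w i) - int i" using assms that unfolding restricted_perms_def by auto
    then show ?thesis by linarith
  qed
  show "w i \<le> i + m" if "1 \<le> i" "i \<le> m + p"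
  proof -
    have "int (w i) - int i \<le> int m" using assms that unfolding restricted_perms_def by auto
    then show ?thesis by linarith
  qed
qed

lemma longest_image_interval:
  assumes "1 \<le> r" "s \<le> n"
  shows "longest n ` {r..s} = {n + 1 - s..n + 1 - r}"
proof
  show "{n + 1 - s..n + 1 - r} \<subseteq> longest n ` {r..s}"
  proof
    fix x assume "x \<in> {n + 1 - s..n + 1 - r}"
    then show "x \<in> longest n ` {r..s}" using assms
      by (intro image_eqI[of _ _ "n + 1 - x"]) (auto simp: longest_def)
  qed
qed (use assms in \<open>auto simp: longest_def\<close>)

text \<open>
  The dots available to \<open>L\<close> are the entries \<open>1\<close> of the first \<open>p\<close> columns and \<open>m\<close> rows of
  the permutation matrix, with the order of the rows reversed by \<open>longest m\<close>.
\<close>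

lemma w11_linking_iff:
  assumes w: "w \<in> restricted_perms m p" and "1 \<le> m" "1 \<le> p"
    and I: "I \<subseteq> {1..m}" and \<Lambda>: "\<Lambda> \<subseteq> {1..p}" and card: "card I = card \<Lambda>"
  shows "(\<exists>L. L \<subseteq> {1..p} \<inter> inv_into UNIV w ` {1..m} \<and> card L = card I \<and> set_le L \<Lambda>
            \<and> set_le I ((longest m \<circ> w) ` L)) \<longleftrightarrow>
    (\<forall>r\<in>{1..m}. \<forall>s\<in>{1..p}.
       card (\<Lambda> \<inter> {1..s}) \<le> card (I \<inter> {1..<r}) + card {j \<in> {1..s}. w j \<le> m + 1 - r})"
proof -
  note w = restricted_permsD[OF w]
  let ?D = "{1..p} \<inter> inv_into UNIV w ` {1..m}"
  have D: "?D = {d \<in> {1..p}. w d \<in> {1..m}}" unfolding w(6) by auto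
  have inj: "inj_on (longest m \<circ> w) ?D" unfolding D
  proof (rule inj_onI)
    fix x y assume "x \<in> {d \<in> {1..p}. w d \<in> {1..m}}" "y \<in> {d \<in> {1..p}. w d \<in> {1..m}}"
      "(longest m \<circ> w) x = (longest m \<circ> w) y"
    then have "w x = w y" by (auto simp: longest_def)
    then show "x = y" unfolding w(5) .
  qed
  have im: "(longest m \<circ> w) ` ?D \<subseteq> {1..m}" unfolding D by (auto simp: longest_def)
  have "{d \<in> ?D. d \<le> s \<and> r \<le> (longest m \<circ> w) d} = {j \<in> {1..s}. w j \<le> m + 1 - r}"
    if "r \<in> {1..m}" "s \<in> {1..p}" for r s
    unfolding D using that w(2) by (auto simp: longest_def)
  then show ?thesis
    using linking_iff[OF _ inj im \<Lambda> I card[symmetric]] assms(2,3) card by (simp add: D)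
qed

text \<open>
  Here rows play the part that columns play in \<open>w11_linking_iff\<close>, and the targets are shifted by
  \<open>m\<close> because the values of \<open>w\<close> at the dots lie in \<open>{m + 1..m + p}\<close>.
\<close>

lemma w22_linking_iff:
  assumes w: "w \<in> restricted_perms m p" and "1 \<le> m" "1 \<le> p"
    and I: "I \<subseteq> {1..m}" and \<Lambda>: "\<Lambda> \<subseteq> {1..p}" and card: "card I = card \<Lambda>"
  shows "(\<exists>L. L \<subseteq> {1..m} \<inter> (longest (m + p) \<circ> inv_into UNIV w) ` {m + 1..m + p} \<and> card L = card \<Lambda>
              \<and> set_le L I \<and> set_le ((\<lambda>l. m + l) ` \<Lambda>) ((w \<circ> longest (m + p)) ` L)) \<longleftrightarrow>
    (\<forall>r\<in>{1..m}. \<forall>s\<in>{1..p}.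
       card (I \<inter> {1..r}) \<le> card (\<Lambda> \<inter> {1..<s}) + card {i \<in> {1..r}. m + s \<le> w (m + p + 1 - i)})"
proof -
  note w = restricted_permsD[OF w]
  let ?D = "{1..m} \<inter> (longest (m + p) \<circ> inv_into UNIV w) ` {m + 1..m + p}"
  let ?M = "(\<lambda>l. m + l) ` \<Lambda>" and ?u = "w \<circ> longest (m + p)"
  have D: "?D = {d \<in> {1..m}. m + 1 \<le> w (m + p + 1 - d)}"
  proof -
    have im: "(longest (m + p) \<circ> inv_into UNIV w) ` {m + 1..m + p} = longest (m + p) ` {j. w j \<in> {m + 1..m + p}}"
      unfolding image_comp[symmetric] w(6) ..
    have "d \<in> longest (m + p) ` {j. w j \<in> {m + 1..m + p}} \<longleftrightarrow> m + 1 \<le> w (m + p + 1 - d)"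
      if d: "d \<in> {1..m}" for d
    proof
      assume "d \<in> longest (m + p) ` {j. w j \<in> {m + 1..m + p}}"
      then obtain j where "w j \<in> {m + 1..m + p}" "d = longest (m + p) j" by auto
      moreover from this have "1 \<le> j \<and> j \<le> m + p" using w(7)[of j] by auto
      ultimately show "m + 1 \<le> w (m + p + 1 - d)" by (auto simp: longest_def)
    next
      assume "m + 1 \<le> w (m + p + 1 - d)"
      then show "d \<in> longest (m + p) ` {j. w j \<in> {m + 1..m + p}}" using d w(2)[of "m + p + 1 - d"]
        by (intro image_eqI[of _ _ "m + p + 1 - d"]) (auto simp: longest_def)
    qed
    then show ?thesis unfolding im by blast
  qed
  have u: "?u d = w (m + p + 1 - d)" if "d \<in> {1..m}" for d using that by (auto simp: longest_def)
  have inj: "inj_on ?u ?D" unfolding D by (auto simp: inj_on_def w(5) longest_def)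
  have im: "?u ` ?D \<subseteq> {m + 1..m + p}" unfolding D
  proof
    fix x assume "x \<in> ?u ` {d \<in> {1..m}. m + 1 \<le> w (m + p + 1 - d)}"
    then obtain d where "d \<in> {1..m}" "m + 1 \<le> w (m + p + 1 - d)" "x = w (m + p + 1 - d)" using u by auto
    then show "x \<in> {m + 1..m + p}" using w(2)[of "m + p + 1 - d"] by auto
  qed
  have M: "?M \<subseteq> {m + 1..m + p}" using \<Lambda> by auto
  have cM: "card I = card ?M" using card by (simp add: card_image inj_on_def)
  have Dc: "{d \<in> ?D. d \<le> r \<and> m + s \<le> ?u d} = {i \<in> {1..r}. m + s \<le> w (m + p + 1 - i)}"
    if "r \<in> {1..m}" "s \<in> {1..p}" for r s
    unfolding D using that u by auto
  have Mc: "card (?M \<inter> {m + 1..<m + s}) = card (\<Lambda> \<inter> {1..<s})" for s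
  proof -
    have "?M \<inter> {m + 1..<m + s} = (\<lambda>l. m + l) ` (\<Lambda> \<inter> {1..<s})" by auto
    then show ?thesis by (simp add: card_image inj_on_def)
  qed
  have all: "(\<forall>t\<in>{m + 1..m + p}. P t) \<longleftrightarrow> (\<forall>s\<in>{1..p}. P (m + s))" for P
  proof
    assume P: "\<forall>s\<in>{1..p}. P (m + s)"
    show "\<forall>t\<in>{m + 1..m + p}. P t"
    proof
      fix t assume "t \<in> {m + 1..m + p}"
      then have "t - m \<in> {1..p}" "m + (t - m) = t" by auto
      then show "P t" using P by metis
    qed
  qed auto
  have "(\<exists>L. L \<subseteq> ?D \<and> card L = card I \<and> set_le L I \<and> set_le ?M (?u ` L)) \<longleftrightarrow>
    (\<forall>t\<in>{m + 1..m + p}. \<forall>r\<in>{1..m}.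
       card (I \<inter> {1..r}) \<le> card (?M \<inter> {m + 1..<t}) + card {d \<in> ?D. d \<le> r \<and> t \<le> ?u d})"
    by (rule linking_iff[OF _ inj im I M cM]) (use assms(2,3) in auto)
  also have "\<dots> \<longleftrightarrow> (\<forall>s\<in>{1..p}. \<forall>r\<in>{1..m}.
       card (I \<inter> {1..r}) \<le> card (?M \<inter> {m + 1..<m + s}) + card {d \<in> ?D. d \<le> r \<and> m + s \<le> ?u d})"
    by (rule all)
  also have "\<dots> \<longleftrightarrow> (\<forall>s\<in>{1..p}. \<forall>r\<in>{1..m}.
       card (I \<inter> {1..r}) \<le> card (\<Lambda> \<inter> {1..<s}) + card {i \<in> {1..r}. m + s \<le> w (m + p + 1 - i)})"
    by (intro ball_cong refl) (simp only: Dc Mc)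
  finally show ?thesis unfolding card by blast
qed

text \<open>
  Since \<open>w j \<le> j + m\<close>, the upper end of the interval \<open>{m + r..m + s}\<close> imposes no
  condition on \<open>j \<in> {r..s}\<close>.
\<close>

lemma w21_interval_iff:
  assumes w: "w \<in> restricted_perms m p" and "1 \<le> r" "r \<le> s" "s \<le> p"
  shows "card ({r..s} - inv_into UNIV w ` {m + r..m + s}) < c \<longleftrightarrow>
    \<not> c + card {j \<in> {r..s}. m + r \<le> w j} \<le> s + 1 - r"
proof -
  note w = restricted_permsD[OF w]
  have "{r..s} - inv_into UNIV w ` {m + r..m + s} = {r..s} - {j \<in> {r..s}. m + r \<le> w j}"
  proof -
    have "w j \<le> m + s" if "j \<in> {r..s}" for j using w(4)[of j] that assms(2-4) by auto
    then show ?thesis unfolding w(6) by auto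
  qed
  also have "card \<dots> = card {r..s} - card {j \<in> {r..s}. m + r \<le> w j}"
    by (rule card_Diff_subset) auto
  finally have "card ({r..s} - inv_into UNIV w ` {m + r..m + s}) = s + 1 - r - card {j \<in> {r..s}. m + r \<le> w j}"
    by simp
  moreover have "card {j \<in> {r..s}. m + r \<le> w j} \<le> card {r..s}" by (intro card_mono) auto
  ultimately show ?thesis by auto
qed

text \<open>
  Dually, \<open>w k \<ge> k - p\<close> forces \<open>j \<ge> r\<close> for all \<open>j\<close> that are counted on the right, so that
  \<open>{1..s}\<close> and \<open>{r..s}\<close> give the same count.
\<close>

lemma w12_interval_iff:
  assumes w: "w \<in> restricted_perms m p" and "1 \<le> r" "r \<le> s" "s \<le> m"
  shows "card (longest (m + p) ` {r..s} - (inv_into UNIV w \<circ> longest m) ` {r..s}) < c \<longleftrightarrow>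
    \<not> c + card {j \<in> {1..s}. w (m + p + 1 - j) \<in> {m + 1 - s..m + 1 - r}} \<le> s + 1 - r"
proof -
  note w = restricted_permsD[OF w]
  let ?V = "{m + 1 - s..m + 1 - r}" and ?N = "m + p + 1"
  let ?J = "{j \<in> {1..s}. w (?N - j) \<in> ?V}"
  have le: "r \<le> j" if "j \<in> ?J" for j
  proof -
    have "?N - j \<le> w (?N - j) + p" using that assms(4) by (intro w(3)) auto
    then show ?thesis using that assms(2-4) by auto
  qed
  have inj: "inj_on (\<lambda>j. ?N - j) ?J" using assms(4) by (auto simp: inj_on_def)
  have sub: "(\<lambda>j. ?N - j) ` ?J \<subseteq> {?N - s..?N - r}" using le assms(4) by force
  have "longest (m + p) ` {r..s} = {?N - s..?N - r}" using assms by (intro longest_image_interval) auto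
  moreover have "(inv_into UNIV w \<circ> longest m) ` {r..s} = {k. w k \<in> ?V}"
    unfolding image_comp[symmetric] using longest_image_interval[of r s m] assms w(6) by simp
  moreover have "{?N - s..?N - r} - {k. w k \<in> ?V} = {?N - s..?N - r} - (\<lambda>j. ?N - j) ` ?J"
  proof -
    have "k \<in> (\<lambda>j. ?N - j) ` ?J" if "k \<in> {?N - s..?N - r}" "w k \<in> ?V" for k
      using that assms(2-4) by (intro image_eqI[of _ _ "?N - k"]) auto
    then show ?thesis by auto
  qed
  ultimately have "card (longest (m + p) ` {r..s} - (inv_into UNIV w \<circ> longest m) ` {r..s})
      = card {?N - s..?N - r} - card ?J"
    using sub inj by (simp add: card_Diff_subset card_image)
  moreover have "card ?J \<le> card {?N - s..?N - r}" using card_mono[OF _ sub] inj by (simp add: card_image)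
  moreover have "card {?N - s..?N - r} = s + 1 - r" using assms by simp
  ultimately show ?thesis by linarith
qed

lemma minor_family_iff:
  assumes w: "w \<in> restricted_perms m p" and "1 \<le> m" "1 \<le> p"
    and I: "I \<subseteq> {1..m}" and \<Lambda>: "\<Lambda> \<subseteq> {1..p}" and card: "card I = card \<Lambda>"
  shows "(I, \<Lambda>) \<in> minor_family m p w \<longleftrightarrow> \<not> interval_bounds m p w I \<Lambda>"
proof -
  have 3: "(\<exists>r s. 1 \<le> r \<and> r \<le> s \<and> s \<le> p \<and>
            card ({r..s} - inv_into UNIV w ` {m + r..m + s}) < card (\<Lambda> \<inter> {r..s})) \<longleftrightarrow>
     \<not> (\<forall>r s. 1 \<le> r \<and> r \<le> s \<and> s \<le> p \<longrightarrow>
       card (\<Lambda> \<inter> {r..s}) + card {j \<in> {r..s}. m + r \<le> w j} \<le> s + 1 - r)"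
    using w21_interval_iff[OF w] by blast
  have 4: "(\<exists>r s. 1 \<le> r \<and> r \<le> s \<and> s \<le> m \<and>
       card (longest (m + p) ` {r..s} - (inv_into UNIV w \<circ> longest m) ` {r..s}) < card (I \<inter> {r..s})) \<longleftrightarrow>
     \<not> (\<forall>r s. 1 \<le> r \<and> r \<le> s \<and> s \<le> m \<longrightarrow>
       card (I \<inter> {r..s}) + card {j \<in> {1..s}. w (m + p + 1 - j) \<in> {m + 1 - s..m + 1 - r}} \<le> s + 1 - r)"
    using w12_interval_iff[OF w] by blast
  have "(I, \<Lambda>) \<in> minor_family m p w \<longleftrightarrow>
     \<not> (\<exists>L. L \<subseteq> {1..p} \<inter> inv_into UNIV w ` {1..m} \<and> card L = card I \<and> set_le L \<Lambda>
            \<and> set_le I ((longest m \<circ> w) ` L)) \<or>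
     \<not> (\<exists>L. L \<subseteq> {1..m} \<inter> (longest (m + p) \<circ> inv_into UNIV w) ` {m + 1..m + p} \<and> card L = card \<Lambda>
              \<and> set_le L I \<and> set_le ((\<lambda>l. m + l) ` \<Lambda>) ((w \<circ> longest (m + p)) ` L)) \<or>
     (\<exists>r s. 1 \<le> r \<and> r \<le> s \<and> s \<le> p \<and>
            card ({r..s} - inv_into UNIV w ` {m + r..m + s}) < card (\<Lambda> \<inter> {r..s})) \<or>
     (\<exists>r s. 1 \<le> r \<and> r \<le> s \<and> s \<le> m \<and>
       card (longest (m + p) ` {r..s} - (inv_into UNIV w \<circ> longest m) ` {r..s}) < card (I \<inter> {r..s}))"
    unfolding minor_family_def mem_Collect_eq prod.case using I \<Lambda> card by blast
  also have "\<dots> \<longleftrightarrow> \<not> interval_bounds m p w I \<Lambda>"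
    unfolding w11_linking_iff[OF assms] w22_linking_iff[OF assms] 3 4 interval_bounds_def by blast
  finally show ?thesis .
qed

section \<open>The rank conditions in terms of the permutation\<close>

lemma longest_mult:
  assumes A: "A \<in> carrier_mat n k"
  shows "perm_mat n (longest n) * A = Matrix.mat n k (\<lambda>(i, j). A $$ (n - 1 - i, j))"
proof (rule eq_matI)
  fix i j
  assume "i < dim_row (Matrix.mat n k (\<lambda>(i, j). A $$ (n - 1 - i, j)))"
    and "j < dim_col (Matrix.mat n k (\<lambda>(i, j). A $$ (n - 1 - i, j)))"
  then have ij: "i < n" "j < k" by auto
  have "(perm_mat n (longest n) * A) $$ (i, j)
      = (\<Sum>l = 0..<n. (if Suc i = longest n (Suc l) then 1 else 0) * A $$ (l, j))"
    using ij A by (simp add: perm_mat_def scalar_prod_def)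
  also have "\<dots> = (\<Sum>l = 0..<n. if l = n - 1 - i then A $$ (l, j) else 0)"
    using ij by (intro sum.cong) (auto simp: longest_def)
  also have "\<dots> = A $$ (n - 1 - i, j)" using ij by (simp add: sum.delta)
  finally show "(perm_mat n (longest n) * A) $$ (i, j)
      = Matrix.mat n k (\<lambda>(i, j). A $$ (n - 1 - i, j)) $$ (i, j)" using ij by simp
qed (use A in \<open>auto simp: perm_mat_def\<close>)

lemma mult_longest:
  assumes A: "A \<in> carrier_mat k n"
  shows "A * perm_mat n (longest n) = Matrix.mat k n (\<lambda>(i, j). A $$ (i, n - 1 - j))"
proof (rule eq_matI)
  fix i j
  assume "i < dim_row (Matrix.mat k n (\<lambda>(i, j). A $$ (i, n - 1 - j)))"
    and "j < dim_col (Matrix.mat k n (\<lambda>(i, j). A $$ (i, n - 1 - j)))"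
  then have ij: "i < k" "j < n" by auto
  have "(A * perm_mat n (longest n)) $$ (i, j)
      = (\<Sum>l = 0..<n. A $$ (i, l) * (if Suc l = longest n (Suc j) then 1 else 0))"
    using ij A by (simp add: perm_mat_def scalar_prod_def)
  also have "\<dots> = (\<Sum>l = 0..<n. if l = n - 1 - j then A $$ (i, l) else 0)"
    using ij by (intro sum.cong) (auto simp: longest_def)
  also have "\<dots> = A $$ (i, n - 1 - j)" using ij by (simp add: sum.delta)
  finally show "(A * perm_mat n (longest n)) $$ (i, j)
      = Matrix.mat k n (\<lambda>(i, j). A $$ (i, n - 1 - j)) $$ (i, j)" using ij by simp
qed (use A in \<open>auto simp: perm_mat_def\<close>)

lemma perm_mat_blocks:
  "w11 m p w = Matrix.mat m p (\<lambda>(i, j). of_bool (Suc i = w (Suc j)))"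
  "w12 m p w = Matrix.mat m m (\<lambda>(i, j). of_bool (Suc i = w (p + Suc j)))"
  "w21 m p w = Matrix.mat p p (\<lambda>(i, j). of_bool (m + Suc i = w (Suc j)))"
  "w22 m p w = Matrix.mat p m (\<lambda>(i, j). of_bool (m + Suc i = w (p + Suc j)))"
  unfolding w11_def w12_def w21_def w22_def
  by (subst block_eq; auto simp: perm_mat_def intro!: eq_matI)+

lemma mat_rank_w11:
  assumes w: "w \<in> restricted_perms m p" and r: "r \<in> {1..m}" and s: "s \<in> {1..p}"
  shows "mat_rank (block (perm_mat m (longest m) * w11 m p w) r m 1 s)
    = card {j \<in> {1..s}. w j \<le> m + 1 - r}"
proof -
  note w = restricted_permsD[OF w]
  let ?S = "{(i, j). i \<in> {1..m} \<and> w j = m + 1 - i}"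
  have "perm_mat m (longest m) * w11 m p w = dot_matrix m p ?S"
    by (subst longest_mult) (auto simp: perm_mat_blocks dot_matrix_def intro!: eq_matI)
  moreover have "inj_on fst ?S" using w(5) by (auto simp: inj_on_def) metis
  moreover have inj: "inj_on snd ?S" by (auto simp: inj_on_def)
  ultimately have "mat_rank (block (perm_mat m (longest m) * w11 m p w) r m 1 s)
      = card (?S \<inter> {r..m} \<times> {1..s})"
    using r s by (simp add: mat_rank_block_dot_matrix)
  also have "\<dots> = card (snd ` (?S \<inter> {r..m} \<times> {1..s}))"
    using inj by (intro card_image[symmetric] inj_on_subset[OF inj]) auto
  also have "snd ` (?S \<inter> {r..m} \<times> {1..s}) = {j \<in> {1..s}. w j \<le> m + 1 - r}"
  proof -
    have "j \<in> snd ` (?S \<inter> {r..m} \<times> {1..s})" if "j \<in> {1..s}" "w j \<le> m + 1 - r" for j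
      using that r s w(2)[of j] by (intro image_eqI[of _ _ "(m + 1 - w j, j)"]) auto
    then show ?thesis by auto
  qed
  finally show ?thesis .
qed

lemma mat_rank_w22:
  assumes w: "w \<in> restricted_perms m p" and r: "r \<in> {1..m}" and s: "s \<in> {1..p}"
  shows "mat_rank (block (perm_mat m (longest m) * transpose_mat (w22 m p w)) 1 r s p)
    = card {i \<in> {1..r}. m + s \<le> w (m + p + 1 - i)}"
proof -
  note w = restricted_permsD[OF w]
  let ?S = "{(i, j). i \<in> {1..m} \<and> w (m + p + 1 - i) = m + j}"
  have "perm_mat m (longest m) * transpose_mat (w22 m p w) = dot_matrix m p ?S"
    by (subst longest_mult)
      (auto simp: perm_mat_blocks dot_matrix_def algebra_simps Suc_diff_Suc intro!: eq_matI)
  moreover have inj: "inj_on fst ?S" by (auto simp: inj_on_def)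
  moreover have "inj_on snd ?S"
  proof (rule inj_onI)
    fix a b assume ab: "a \<in> ?S" "b \<in> ?S" "snd a = snd b"
    then have "w (m + p + 1 - fst a) = w (m + p + 1 - fst b)" by auto
    then have "m + p + 1 - fst a = m + p + 1 - fst b" unfolding w(5) .
    moreover have "fst a \<le> m" "fst b \<le> m" using ab by auto
    ultimately have "fst a = fst b" by linarith
    then show "a = b" using ab by (simp add: prod_eq_iff)
  qed
  ultimately have "mat_rank (block (perm_mat m (longest m) * transpose_mat (w22 m p w)) 1 r s p)
      = card (?S \<inter> {1..r} \<times> {s..p})"
    using r s by (simp add: mat_rank_block_dot_matrix)
  also have "\<dots> = card (fst ` (?S \<inter> {1..r} \<times> {s..p}))"
    using inj by (intro card_image[symmetric] inj_on_subset[OF inj]) auto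
  also have "fst ` (?S \<inter> {1..r} \<times> {s..p}) = {i \<in> {1..r}. m + s \<le> w (m + p + 1 - i)}"
  proof -
    have "i \<in> fst ` (?S \<inter> {1..r} \<times> {s..p})" if "i \<in> {1..r}" "m + s \<le> w (m + p + 1 - i)" for i
    proof -
      have "1 \<le> m + p + 1 - i" "m + p + 1 - i \<le> m + p" using that r by auto
      then have "w (m + p + 1 - i) \<le> m + p" using w(2) by blast
      then show ?thesis
        using that r s by (intro image_eqI[of _ _ "(i, w (m + p + 1 - i) - m)"]) auto
    qed
    then show ?thesis by auto
  qed
  finally show ?thesis .
qed

lemma mat_rank_w21:
  assumes w: "w \<in> restricted_perms m p" and rs: "1 \<le> r" "r \<le> s" "s \<le> p"
  shows "mat_rank (block (w21 m p w) r p r s) = card {j \<in> {r..s}. m + r \<le> w j}"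
proof -
  note w = restricted_permsD[OF w]
  let ?S = "{(i, j). w j = m + i}"
  have "w21 m p w = dot_matrix p p ?S"
    by (auto simp: perm_mat_blocks dot_matrix_def intro!: eq_matI)
  moreover have "inj_on fst ?S" using w(5) by (auto simp: inj_on_def) metis
  moreover have inj: "inj_on snd ?S" by (auto simp: inj_on_def)
  ultimately have "mat_rank (block (w21 m p w) r p r s) = card (?S \<inter> {r..p} \<times> {r..s})"
    using rs by (simp add: mat_rank_block_dot_matrix)
  also have "\<dots> = card (snd ` (?S \<inter> {r..p} \<times> {r..s}))"
    using inj by (intro card_image[symmetric] inj_on_subset[OF inj]) auto
  also have "snd ` (?S \<inter> {r..p} \<times> {r..s}) = {j \<in> {r..s}. m + r \<le> w j}"
  proof -
    have "j \<in> snd ` (?S \<inter> {r..p} \<times> {r..s})" if "j \<in> {r..s}" "m + r \<le> w j" for j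
      using that rs w(2)[of j] by (intro image_eqI[of _ _ "(w j - m, j)"]) auto
    then show ?thesis by auto
  qed
  finally show ?thesis .
qed

lemma mat_rank_w12:
  assumes w: "w \<in> restricted_perms m p" and rs: "1 \<le> r" "r \<le> s" "s \<le> m"
  shows "mat_rank (block (perm_mat m (longest m) * w12 m p w * perm_mat m (longest m)) r s 1 s)
    = card {j \<in> {1..s}. w (m + p + 1 - j) \<in> {m + 1 - s..m + 1 - r}}"
proof -
  note w = restricted_permsD[OF w]
  let ?W = "perm_mat m (longest m) * w12 m p w * perm_mat m (longest m)"
  let ?S = "{(i, j). i \<in> {1..m} \<and> j \<in> {1..m} \<and> w (m + p + 1 - j) = m + 1 - i}"
  have c: "perm_mat m (longest m) * w12 m p w \<in> carrier_mat m m"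
    by (auto simp: perm_mat_def perm_mat_blocks)
  have "?W = dot_matrix m m ?S"
    unfolding mult_longest[OF c]
    by (subst longest_mult)
      (auto simp: perm_mat_blocks dot_matrix_def algebra_simps Suc_diff_Suc intro!: eq_matI)
  moreover have "inj_on fst ?S"
  proof (rule inj_onI)
    fix a b assume ab: "a \<in> ?S" "b \<in> ?S" "fst a = fst b"
    then have "w (m + p + 1 - snd a) = w (m + p + 1 - snd b)" by auto
    then have "m + p + 1 - snd a = m + p + 1 - snd b" unfolding w(5) .
    moreover have "snd a \<le> m" "snd b \<le> m" using ab by auto
    ultimately have "snd a = snd b" by linarith
    then show "a = b" using ab by (simp add: prod_eq_iff)
  qed
  moreover have inj: "inj_on snd ?S" by (auto simp: inj_on_def)
  ultimately have "mat_rank (block ?W r s 1 s) = card (?S \<inter> {r..s} \<times> {1..s})"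
    using rs by (simp add: mat_rank_block_dot_matrix)
  also have "\<dots> = card (snd ` (?S \<inter> {r..s} \<times> {1..s}))"
    using inj by (intro card_image[symmetric] inj_on_subset[OF inj]) auto
  also have "snd ` (?S \<inter> {r..s} \<times> {1..s}) = {j \<in> {1..s}. w (m + p + 1 - j) \<in> {m + 1 - s..m + 1 - r}}"
  proof -
    have "j \<in> snd ` (?S \<inter> {r..s} \<times> {1..s})"
      if "j \<in> {1..s}" "w (m + p + 1 - j) \<in> {m + 1 - s..m + 1 - r}" for j
      using that rs by (intro image_eqI[of _ _ "(m + 1 - w (m + p + 1 - j), j)"]) auto
    then show ?thesis using rs by auto
  qed
  finally show ?thesis .
qed

text \<open>
  The bounds here are the counts that occur in \<open>interval_bounds\<close>. The two lists differ at
  the ends of the ranges only: the variety has no condition for the column intervals with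
  \<open>r = 1\<close> and the row intervals with \<open>s = m\<close>.
\<close>

lemma rank_variety_iff:
  assumes w: "w \<in> restricted_perms m p"
  shows "x \<in> rank_variety m p w \<longleftrightarrow> x \<in> carrier_mat m p \<and>
    (\<forall>r\<in>{1..m}. \<forall>s\<in>{1..p}. mat_rank (block x r m 1 s) \<le> card {j \<in> {1..s}. w j \<le> m + 1 - r}) \<and>
    (\<forall>r\<in>{1..m}. \<forall>s\<in>{1..p}.
       mat_rank (block x 1 r s p) \<le> card {i \<in> {1..r}. m + s \<le> w (m + p + 1 - i)}) \<and>
    (\<forall>r s. 2 \<le> r \<and> r \<le> s \<and> s \<le> p \<longrightarrow>
       mat_rank (block x 1 m r s) + card {j \<in> {r..s}. m + r \<le> w j} \<le> s + 1 - r) \<and>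
    (\<forall>r s. 1 \<le> r \<and> r \<le> s \<and> s \<le> m - 1 \<longrightarrow>
       mat_rank (block x r s 1 p) + card {j \<in> {1..s}. w (m + p + 1 - j) \<in> {m + 1 - s..m + 1 - r}}
         \<le> s + 1 - r)"
proof -
  have int: "int a \<le> int s + 1 - int r - int b \<longleftrightarrow> a + b \<le> s + 1 - r" if "r \<le> s" for a b r s :: nat
    using that by linarith
  have 3: "(2 \<le> r \<and> r \<le> s \<and> s \<le> p \<longrightarrow> int (mat_rank (block x 1 m r s))
           \<le> int s + 1 - int r - int (mat_rank (block (w21 m p w) r p r s))) \<longleftrightarrow>
    (2 \<le> r \<and> r \<le> s \<and> s \<le> p \<longrightarrow>
       mat_rank (block x 1 m r s) + card {j \<in> {r..s}. m + r \<le> w j} \<le> s + 1 - r)" for r s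
    using int mat_rank_w21[OF w, of r s] by auto
  have 4: "(1 \<le> r \<and> r \<le> s \<and> s \<le> m - 1 \<longrightarrow> int (mat_rank (block x r s 1 p))
           \<le> int s + 1 - int r - int (mat_rank
                (block (perm_mat m (longest m) * w12 m p w * perm_mat m (longest m)) r s 1 s))) \<longleftrightarrow>
    (1 \<le> r \<and> r \<le> s \<and> s \<le> m - 1 \<longrightarrow>
       mat_rank (block x r s 1 p) + card {j \<in> {1..s}. w (m + p + 1 - j) \<in> {m + 1 - s..m + 1 - r}}
         \<le> s + 1 - r)" for r s
    using int mat_rank_w12[OF w, of r s] by auto
  show ?thesis unfolding rank_variety_def mem_Collect_eq 3 4
    by (simp only: mat_rank_w11[OF w] mat_rank_w22[OF w] cong: ball_cong)
qed

text \<open>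
  Each inequality is \<open>minor_nonzero_card_le\<close> for the block that appears in the corresponding
  rank condition. The column intervals with \<open>r = 1\<close> and the row intervals with \<open>s = m\<close> are
  corner blocks, governed by the first rank condition.
\<close>

lemma minor_nonzero_imp_interval_bounds:
  assumes w: "w \<in> restricted_perms m p" and mp: "1 \<le> m" "1 \<le> p"
    and I: "I \<subseteq> {1..m}" and \<Lambda>: "\<Lambda> \<subseteq> {1..p}" and card: "card I = card \<Lambda>"
    and x: "x \<in> rank_variety m p w" and nz: "minor I \<Lambda> x \<noteq> 0"
  shows "interval_bounds m p w I \<Lambda>"
proof -
  have fin: "finite I" "finite \<Lambda>" using I \<Lambda> finite_subset by blast+
  have split: "card X = card (X - Y) + card (X \<inter> Y)" if "finite X" for X Y :: "nat set"
    using card_Int_Diff[OF that, of Y] by simp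
  note x = x[unfolded rank_variety_iff[OF w]]
  note minor_le = minor_nonzero_card_le[OF conjunct1[OF x] I \<Lambda> card nz]
  show ?thesis unfolding interval_bounds_def
  proof (intro conjI ballI allI impI)
    fix r s assume rs: "r \<in> {1..m}" "s \<in> {1..p}"
    have "card I \<le> card (I - {r..m}) + card (\<Lambda> - {1..s}) + mat_rank (block x r m 1 s)"
      using rs by (intro minor_le) auto
    moreover have "mat_rank (block x r m 1 s) \<le> card {j \<in> {1..s}. w j \<le> m + 1 - r}" using x rs by blast
    moreover have "I - {r..m} = I \<inter> {1..<r}" using I rs by auto
    ultimately show "card (\<Lambda> \<inter> {1..s}) \<le> card (I \<inter> {1..<r}) + card {j \<in> {1..s}. w j \<le> m + 1 - r}"
      using split[OF fin(2), of "{1..s}"] card by simp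
  next
    fix r s assume rs: "r \<in> {1..m}" "s \<in> {1..p}"
    have "card I \<le> card (I - {1..r}) + card (\<Lambda> - {s..p}) + mat_rank (block x 1 r s p)"
      using rs by (intro minor_le) auto
    moreover have "mat_rank (block x 1 r s p) \<le> card {i \<in> {1..r}. m + s \<le> w (m + p + 1 - i)}"
      using x rs by blast
    moreover have "\<Lambda> - {s..p} = \<Lambda> \<inter> {1..<s}" using \<Lambda> rs by auto
    ultimately show "card (I \<inter> {1..r}) \<le> card (\<Lambda> \<inter> {1..<s}) + card {i \<in> {1..r}. m + s \<le> w (m + p + 1 - i)}"
      using split[OF fin(1), of "{1..r}"] by simp
  next
    fix r s assume rs: "1 \<le> r \<and> r \<le> s \<and> s \<le> p"
    have "card I \<le> card (I - {1..m}) + card (\<Lambda> - {r..s}) + mat_rank (block x 1 m r s)"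
      using rs by (intro minor_le) auto
    moreover have "I - {1..m} = {}" using I by auto
    then have "card (I - {1..m}) = 0" by (simp only: card.empty)
    ultimately have "card (\<Lambda> \<inter> {r..s}) \<le> mat_rank (block x 1 m r s)"
      using split[OF fin(2), of "{r..s}"] card by linarith
    moreover have "mat_rank (block x 1 m r s) + card {j \<in> {r..s}. m + r \<le> w j} \<le> s + 1 - r"
    proof (cases "r = 1")
      case True
      \<comment> \<open>The corner block with all rows: each of the first \<open>s\<close> values of \<open>w\<close> is at most \<open>m\<close> or
        greater.\<close>
      have "{1..s} - {j \<in> {1..s}. w j \<le> m + 1 - 1} = {j \<in> {1..s}. m + 1 \<le> w j}"
        "{1..s} \<inter> {j \<in> {1..s}. w j \<le> m + 1 - 1} = {j \<in> {1..s}. w j \<le> m + 1 - 1}" by auto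
      then have "card {j \<in> {1..s}. w j \<le> m + 1 - 1} + card {j \<in> {1..s}. m + 1 \<le> w j} = s"
        using split[of "{1..s}" "{j \<in> {1..s}. w j \<le> m + 1 - 1}"] by simp
      moreover have "1 \<in> {1..m}" "s \<in> {1..p}" using rs mp by auto
      then have "mat_rank (block x 1 m 1 s) \<le> card {j \<in> {1..s}. w j \<le> m + 1 - 1}" using x by blast
      ultimately show ?thesis unfolding True by linarith
    next
      case False
      then have "2 \<le> r \<and> r \<le> s \<and> s \<le> p" using rs by auto
      then show ?thesis using x by blast
    qed
    ultimately show "card (\<Lambda> \<inter> {r..s}) + card {j \<in> {r..s}. m + r \<le> w j} \<le> s + 1 - r" by linarith
  next
    fix r s assume rs: "1 \<le> r \<and> r \<le> s \<and> s \<le> m"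
    let ?V = "{m + 1 - s..m + 1 - r}"
    have "card I \<le> card (I - {r..s}) + card (\<Lambda> - {1..p}) + mat_rank (block x r s 1 p)"
      using rs by (intro minor_le) auto
    moreover have "\<Lambda> - {1..p} = {}" using \<Lambda> by auto
    then have "card (\<Lambda> - {1..p}) = 0" by (simp only: card.empty)
    ultimately have "card (I \<inter> {r..s}) \<le> mat_rank (block x r s 1 p)"
      using split[OF fin(1), of "{r..s}"] by linarith
    moreover have "mat_rank (block x r s 1 p) + card {j \<in> {1..s}. w (m + p + 1 - j) \<in> ?V} \<le> s + 1 - r"
    proof (cases "s = m")
      case True
      \<comment> \<open>The \<open>m + 1 - r\<close> smallest values of \<open>w\<close> are taken either in the first \<open>p\<close> positions, where they
        give the rank of the corner block, or in the last \<open>m\<close>.\<close>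
      note w = restricted_permsD[OF w]
      let ?K = "{k. w k \<in> {1..m + 1 - r}}"
      let ?J = "{j \<in> {1..m}. w (m + p + 1 - j) \<in> {1..m + 1 - r}}"
      have "?K = inv_into UNIV w ` {1..m + 1 - r}" unfolding w(6) ..
      moreover have "inj (inv_into UNIV w)" using bij_imp_bij_inv[OF w(1)] by (simp add: bij_is_inj)
      ultimately have K: "card ?K = m + 1 - r" "finite ?K"
        by (simp_all add: card_image inj_on_subset[OF _ subset_UNIV])
      have "?K - {1..p} = (\<lambda>j. m + p + 1 - j) ` ?J"
      proof -
        have "k \<in> (\<lambda>j. m + p + 1 - j) ` ?J" if "k \<in> ?K" "k \<notin> {1..p}" for k
        proof -
          have "1 \<le> k \<and> k \<le> m + p" using that(1) rs by (intro w(7)) auto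
          then show ?thesis using that by (intro image_eqI[of _ _ "m + p + 1 - k"]) auto
        qed
        then show ?thesis by auto
      qed
      moreover have "inj_on (\<lambda>j. m + p + 1 - j) ?J"
      proof (rule inj_onI)
        fix i j assume ij: "i \<in> ?J" "j \<in> ?J" and eq: "m + p + 1 - i = m + p + 1 - j"
        have "i \<le> m" "j \<le> m" using ij by auto
        then show "i = j" using eq by linarith
      qed
      ultimately have "card (?K - {1..p}) = card ?J" by (simp only: card_image)
      moreover have "?K \<inter> {1..p} = {j \<in> {1..p}. w j \<le> m + 1 - r}" using w(2) by auto
      ultimately have "card ?J + card {j \<in> {1..p}. w j \<le> m + 1 - r} = m + 1 - r"
        using split[OF K(2), of "{1..p}"] K(1) by simp
      moreover have "r \<in> {1..m}" "p \<in> {1..p}" using rs mp by auto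
      then have "mat_rank (block x r m 1 p) \<le> card {j \<in> {1..p}. w j \<le> m + 1 - r}" using x by blast
      ultimately show ?thesis unfolding True by simp
    next
      case False
      then have "1 \<le> r \<and> r \<le> s \<and> s \<le> m - 1" using rs by auto
      then show ?thesis using x by blast
    qed
    ultimately show "card (I \<inter> {r..s}) + card {j \<in> {1..s}. w (m + p + 1 - j) \<in> ?V} \<le> s + 1 - r" by linarith
  qed
qed

section \<open>A matrix in the variety with a nonzero minor\<close>

text \<open>
  The graph of the increasing bijection from \<open>I\<close> to \<open>\<Lambda>\<close> when these have equal size:
  \<open>card {a \<in> I. a < i}\<close> is the position of \<open>i\<close> in \<open>I\<close>, counted from \<open>0\<close>.
\<close>

definition order_matching :: "nat set \<Rightarrow> nat set \<Rightarrow> (nat \<times> nat) set" where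
  "order_matching I \<Lambda> = {(i, j) \<in> I \<times> \<Lambda>. card {a \<in> I. a < i} = card {b \<in> \<Lambda>. b < j}}"

lemma position_eq_iff:
  fixes I :: "nat set"
  assumes "finite I" "i \<in> I" "i' \<in> I"
  shows "card {a \<in> I. a < i} = card {a \<in> I. a < i'} \<longleftrightarrow> i = i'"
proof -
  have less: "card {a \<in> I. a < i} < card {a \<in> I. a < i'}" if "i < i'" "i \<in> I" for i i'
    using assms(1) that by (intro psubset_card_mono) auto
  show ?thesis using less[of i i'] less[of i' i] assms by (cases i i' rule: linorder_cases) auto
qed

lemma inj_order_matching:
  assumes "finite I" "finite \<Lambda>"
  shows "inj_on fst (order_matching I \<Lambda>)" "inj_on snd (order_matching I \<Lambda>)"
proof -
  have "fst s = fst t \<longleftrightarrow> snd s = snd t"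
    if st: "s \<in> order_matching I \<Lambda>" "t \<in> order_matching I \<Lambda>" for s t
  proof -
    have "fst s = fst t \<longleftrightarrow> card {a \<in> I. a < fst s} = card {a \<in> I. a < fst t}"
      using st by (intro position_eq_iff[symmetric] assms) (auto simp: order_matching_def)
    also have "\<dots> \<longleftrightarrow> card {b \<in> \<Lambda>. b < snd s} = card {b \<in> \<Lambda>. b < snd t}"
      using st by (auto simp: order_matching_def)
    also have "\<dots> \<longleftrightarrow> snd s = snd t"
      using st by (intro position_eq_iff assms) (auto simp: order_matching_def)
    finally show ?thesis .
  qed
  then show "inj_on fst (order_matching I \<Lambda>)" "inj_on snd (order_matching I \<Lambda>)"
    unfolding inj_on_def prod_eq_iff by blast+
qed

text \<open>
  Matching \<open>I\<close> with \<open>\<Lambda>\<close> in increasing order puts as few dots as possible into all corner blocks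
  at once. The dots are numbered by their common position in \<open>I\<close> and \<open>\<Lambda>\<close>; a dot in rows
  \<open>\<ge> r\<close> has position at least \<open>card (I \<inter> {1..<r})\<close>, and one in columns \<open>\<le> s'\<close> has position less
  than \<open>card (\<Lambda> \<inter> {1..s'})\<close>. The second bound is the same with rows and columns exchanged.
\<close>

lemma card_order_matching_box:
  assumes I: "finite I" "0 \<notin> I" and \<Lambda>: "finite \<Lambda>" "0 \<notin> \<Lambda>"
  shows "card (order_matching I \<Lambda> \<inter> {r..r'} \<times> {s..s'}) \<le> card (\<Lambda> \<inter> {1..s'}) - card (I \<inter> {1..<r})" (is "?c \<le> ?c1")
    and "card (order_matching I \<Lambda> \<inter> {r..r'} \<times> {s..s'}) \<le> card (I \<inter> {1..r'}) - card (\<Lambda> \<inter> {1..<s})" (is "?c \<le> ?c2")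
    and "card (order_matching I \<Lambda> \<inter> {r..r'} \<times> {s..s'}) \<le> card (\<Lambda> \<inter> {s..s'})"
    and "card (order_matching I \<Lambda> \<inter> {r..r'} \<times> {s..s'}) \<le> card (I \<inter> {r..r'})"
proof -
  let ?T = "order_matching I \<Lambda> \<inter> {r..r'} \<times> {s..s'}"
  let ?h = "\<lambda>t. card {a \<in> I. a < fst t}"
  note inj = inj_order_matching[OF I(1) \<Lambda>(1)]
  have "inj_on ?h ?T"
  proof (rule inj_onI)
    fix s t assume st: "s \<in> ?T" "t \<in> ?T" and e: "?h s = ?h t"
    have "fst s = fst t"
      using e st position_eq_iff[OF I(1), of "fst s" "fst t"] unfolding order_matching_def by auto
    then show "s = t" using inj(1) st by (auto dest: inj_onD)
  qed
  then have card: "?c = card (?h ` ?T)" by (simp add: card_image)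
  have "card (I \<inter> {1..<r}) \<le> ?h t" "?h t < card (\<Lambda> \<inter> {1..s'})"
    "card (\<Lambda> \<inter> {1..<s}) \<le> ?h t" "?h t < card (I \<inter> {1..r'})" if "t \<in> ?T" for t
  proof -
    obtain i j where t: "t = (i, j)" "i \<in> I" "j \<in> \<Lambda>" "r \<le> i" "i \<le> r'" "s \<le> j" "j \<le> s'"
      and h: "?h t = card {b \<in> \<Lambda>. b < j}" using \<open>t \<in> ?T\<close> unfolding order_matching_def by auto
    have nz: "i \<noteq> 0" "j \<noteq> 0" using t(2,3) I(2) \<Lambda>(2) by metis+
    show "card (I \<inter> {1..<r}) \<le> ?h t" using t I by (intro card_mono) auto
    show "card (\<Lambda> \<inter> {1..<s}) \<le> ?h t" unfolding h using t \<Lambda> by (intro card_mono) auto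
    have "{b \<in> \<Lambda>. b < j} \<subset> \<Lambda> \<inter> {1..s'}"
    proof
      show "{b \<in> \<Lambda>. b < j} \<subseteq> \<Lambda> \<inter> {1..s'}" using t \<Lambda> by (auto simp: Suc_le_eq intro: gr0I)
      show "{b \<in> \<Lambda>. b < j} \<noteq> \<Lambda> \<inter> {1..s'}" using t nz by force
    qed
    then show "?h t < card (\<Lambda> \<inter> {1..s'})" unfolding h using \<Lambda> by (intro psubset_card_mono) auto
    have "{a \<in> I. a < i} \<subset> I \<inter> {1..r'}"
    proof
      show "{a \<in> I. a < i} \<subseteq> I \<inter> {1..r'}" using t I by (auto simp: Suc_le_eq intro: gr0I)
      show "{a \<in> I. a < i} \<noteq> I \<inter> {1..r'}" using t nz by force
    qed
    then show "?h t < card (I \<inter> {1..r'})" unfolding t(1) fst_conv using I by (intro psubset_card_mono) auto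
  qed
  then have sub: "?h ` ?T \<subseteq> {card (I \<inter> {1..<r})..<card (\<Lambda> \<inter> {1..s'})}"
    "?h ` ?T \<subseteq> {card (\<Lambda> \<inter> {1..<s})..<card (I \<inter> {1..r'})}" by auto
  show "?c \<le> ?c1" "?c \<le> ?c2" unfolding card
    using card_mono[OF finite_atLeastLessThan sub(1)] card_mono[OF finite_atLeastLessThan sub(2)]
    by (simp_all only: card_atLeastLessThan)
  have "snd ` ?T \<subseteq> \<Lambda> \<inter> {s..s'}" "fst ` ?T \<subseteq> I \<inter> {r..r'}" unfolding order_matching_def by auto
  then show "?c \<le> card (\<Lambda> \<inter> {s..s'})" "?c \<le> card (I \<inter> {r..r'})"
    using card_inj_on_le[of snd ?T "\<Lambda> \<inter> {s..s'}"] card_inj_on_le[of fst ?T "I \<inter> {r..r'}"]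
      inj_on_subset[OF inj(1), of ?T] inj_on_subset[OF inj(2), of ?T] I \<Lambda> by auto
qed

text \<open>
  Taking rows \<open>I\<close> and columns \<open>\<Lambda>\<close> in increasing order turns the matching into the identity
  matrix.
\<close>

lemma minor_order_matching:
  assumes I: "I \<subseteq> {1..m}" and \<Lambda>: "\<Lambda> \<subseteq> {1..p}" and card: "card I = card \<Lambda>"
  shows "minor I \<Lambda> (dot_matrix m p (order_matching I \<Lambda>)) = 1"
proof -
  let ?I = "{i. Suc i \<in> I}" and ?L = "{i. Suc i \<in> \<Lambda>}"
  have Suc_card: "card {b \<in> X. b < Suc k} = card {i \<in> {i. Suc i \<in> X}. i < k}" if "X \<subseteq> {1..n}" for X k n
  proof -
    have "{b \<in> X. b < Suc k} = Suc ` {i \<in> {i. Suc i \<in> X}. i < k}"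
    proof
      show "{b \<in> X. b < Suc k} \<subseteq> Suc ` {i \<in> {i. Suc i \<in> X}. i < k}"
      proof
        fix b assume b: "b \<in> {b \<in> X. b < Suc k}"
        then have "1 \<le> b" using that by auto
        then show "b \<in> Suc ` {i \<in> {i. Suc i \<in> X}. i < k}" using b
          by (intro image_eqI[of _ _ "b - 1"]) auto
      qed
    qed auto
    from arg_cong[OF this, of card] show ?thesis by (simp add: card_image)
  qed
  have "submatrix (dot_matrix m p (order_matching I \<Lambda>)) ?I ?L = 1\<^sub>m (card I)"
  proof (rule eq_matI)
    fix i j assume "i < dim_row (1\<^sub>m (card I) :: complex mat)" "j < dim_col (1\<^sub>m (card I) :: complex mat)"
    then have ij: "i < card I" "j < card \<Lambda>" using card by auto
    note pi = pick_shifted[OF I ij(1)] and pj = pick_shifted[OF \<Lambda> ij(2)]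
    have "(Suc (pick ?I i), Suc (pick ?L j)) \<in> order_matching I \<Lambda> \<longleftrightarrow> i = j"
      unfolding order_matching_def using pi pj Suc_card[OF I] Suc_card[OF \<Lambda>] by simp
    then show "submatrix (dot_matrix m p (order_matching I \<Lambda>)) ?I ?L $$ (i, j) = 1\<^sub>m (card I) $$ (i, j)"
      using ij card pi(2) pj(2) card_shifted[OF I] card_shifted[OF \<Lambda>]
      by (subst submatrix_index) (auto simp: dot_matrix_def)
  qed (use card card_shifted[OF I] card_shifted[OF \<Lambda>] in \<open>auto simp: dim_submatrix dot_matrix_def\<close>)
  then show ?thesis unfolding minor_def by simp
qed

text \<open>
  The four bounds of \<open>card_order_matching_box\<close> are what \<open>interval_bounds\<close> compares with the
  rank conditions. In the first two, the truncated subtraction expresses that a block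
  without dots satisfies its condition whatever the counts are.
\<close>

lemma order_matching_in_rank_variety:
  assumes w: "w \<in> restricted_perms m p" and I: "I \<subseteq> {1..m}" and \<Lambda>: "\<Lambda> \<subseteq> {1..p}"
    and bounds: "interval_bounds m p w I \<Lambda>"
  shows "dot_matrix m p (order_matching I \<Lambda>) \<in> rank_variety m p w"
proof -
  let ?T = "order_matching I \<Lambda>"
  have fin: "finite I" "finite \<Lambda>" using I \<Lambda> finite_subset by blast+
  have nz: "0 \<notin> I" "0 \<notin> \<Lambda>" using I \<Lambda> by auto
  note box = card_order_matching_box[OF fin(1) nz(1) fin(2) nz(2)]
  note rank = mat_rank_block_dot_matrix[OF inj_order_matching[OF fin]]
  note bounds = bounds[unfolded interval_bounds_def]
  show ?thesis unfolding rank_variety_iff[OF w]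
  proof (intro conjI ballI allI impI)
    show "dot_matrix m p ?T \<in> carrier_mat m p" by (simp add: dot_matrix_def)
  next
    fix r s assume rs: "r \<in> {1..m}" "s \<in> {1..p}"
    then have "mat_rank (block (dot_matrix m p ?T) r m 1 s) = card (?T \<inter> {r..m} \<times> {1..s})"
      by (intro rank) auto
    moreover have "card (\<Lambda> \<inter> {1..s}) \<le> card (I \<inter> {1..<r}) + card {j \<in> {1..s}. w j \<le> m + 1 - r}"
      using bounds rs by blast
    ultimately show "mat_rank (block (dot_matrix m p ?T) r m 1 s) \<le> card {j \<in> {1..s}. w j \<le> m + 1 - r}"
      using box(1)[of r m 1 s] by linarith
  next
    fix r s assume rs: "r \<in> {1..m}" "s \<in> {1..p}"
    then have "mat_rank (block (dot_matrix m p ?T) 1 r s p) = card (?T \<inter> {1..r} \<times> {s..p})"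
      by (intro rank) auto
    moreover have "card (I \<inter> {1..r}) \<le> card (\<Lambda> \<inter> {1..<s}) + card {i \<in> {1..r}. m + s \<le> w (m + p + 1 - i)}"
      using bounds rs by blast
    ultimately show "mat_rank (block (dot_matrix m p ?T) 1 r s p) \<le> card {i \<in> {1..r}. m + s \<le> w (m + p + 1 - i)}"
      using box(2)[of 1 r s p] by linarith
  next
    fix r s assume rs: "2 \<le> r \<and> r \<le> s \<and> s \<le> p"
    then have "mat_rank (block (dot_matrix m p ?T) 1 m r s) = card (?T \<inter> {1..m} \<times> {r..s})"
      by (intro rank) auto
    moreover have "1 \<le> r \<and> r \<le> s \<and> s \<le> p" using rs by auto
    then have "card (\<Lambda> \<inter> {r..s}) + card {j \<in> {r..s}. m + r \<le> w j} \<le> s + 1 - r" using bounds by blast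
    ultimately show "mat_rank (block (dot_matrix m p ?T) 1 m r s) + card {j \<in> {r..s}. m + r \<le> w j} \<le> s + 1 - r"
      using box(3)[of 1 m r s] by linarith
  next
    fix r s assume rs: "1 \<le> r \<and> r \<le> s \<and> s \<le> m - 1"
    let ?c = "card {j \<in> {1..s}. w (m + p + 1 - j) \<in> {m + 1 - s..m + 1 - r}}"
    have "mat_rank (block (dot_matrix m p ?T) r s 1 p) = card (?T \<inter> {r..s} \<times> {1..p})"
      using rs by (intro rank) auto
    moreover have "1 \<le> r \<and> r \<le> s \<and> s \<le> m" using rs by auto
    then have "card (I \<inter> {r..s}) + ?c \<le> s + 1 - r" using bounds by blast
    ultimately show "mat_rank (block (dot_matrix m p ?T) r s 1 p) + ?c \<le> s + 1 - r"
      using box(4)[of r s 1 p] by linarith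
  qed
qed

theorem theorem2p11:
  fixes m p :: nat and w :: "nat \<Rightarrow> nat" and I \<Lambda> :: "nat set" and P :: "complex mat set"
  assumes "m \<ge> 2" and "p \<ge> 2"
    and "w \<in> restricted_perms m p"
    and "is_leaf_orbit_of m p w P"
    and "I \<subseteq> {1..m}" and "\<Lambda> \<subseteq> {1..p}" and "card I = card \<Lambda>"
  shows "(I, \<Lambda>) \<in> minor_family m p w \<longleftrightarrow>
         (\<forall>x \<in> mat_topology m p closure_of P. minor I \<Lambda> x = 0)"
proof -
  have closure: "mat_topology m p closure_of P = rank_variety m p w"
    using assms(4) unfolding is_leaf_orbit_of_def by simp
  have mp: "1 \<le> m" "1 \<le> p" using assms by auto
  have "interval_bounds m p w I \<Lambda> \<longleftrightarrow> (\<exists>x \<in> rank_variety m p w. minor I \<Lambda> x \<noteq> 0)"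
  proof
    assume "interval_bounds m p w I \<Lambda>"
    then show "\<exists>x \<in> rank_variety m p w. minor I \<Lambda> x \<noteq> 0"
      using order_matching_in_rank_variety[OF assms(3,5,6)] minor_order_matching[OF assms(5-7)]
      by (metis one_neq_zero)
  next
    assume "\<exists>x \<in> rank_variety m p w. minor I \<Lambda> x \<noteq> 0"
    then show "interval_bounds m p w I \<Lambda>"
      using minor_nonzero_imp_interval_bounds[OF assms(3) mp assms(5-7)] by blast
  qed
  then show ?thesis unfolding minor_family_iff[OF assms(3) mp assms(5-7)] closure by blast
qed

end
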